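(* Let $\mathcal B'\subset\mathcal B$ be finite sets and let $\vec{\mathcal H}'$ be a finite sequence of conjugacy classes of finitely generated subgroups of $F(\mathcal B')$. Then $\vec{\mathcal H}'$ is a Gersten representative with respect to $\mathcal B'$ (i.e. of minimal complexity in its $\mathrm{Aut}(F(\mathcal B'))$-orbit, computed with $\mathcal B'$-graphs) if and only if $\vec{\mathcal H}'$, regarded as a sequence of conjugacy classes of subgroups of $F(\mathcal B)\supset F(\mathcal B')$, is a Gersten representative with respect to $\mathcal B$.
   Context: $F(\mathcal B)$ is the free group on $\mathcal B$, identified with $\pi_1$ of the rose $R_{\mathcal B}$. For a conjugacy class $[[H]]$ of a finitely generated subgroup, $\Sigma([[H]])$ is the core of the covering graph of $R_{\mathcal B}$ corresponding to $H$, a finite graph with oriented edges labeled in $\mathcal B^{\pm1}$ (empty if $H=1$). The complexity $c(\vec{\mathcal H})$ of a sequence is the total number of edges of the graphs $\Sigma(\mathcal H_i)$; automorphisms act componentwise. A sequence is a Gersten representative (with respect to $\mathcal B$) if its complexity is minimal among all $\alpha\vec{\mathcal H}$, $\alpha\in\mathrm{Aut}(F(\mathcal B))$. *)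

theory Defs
  imports "HOL-Algebra.Group" "HOL-Algebra.Coset" "HOL-Algebra.Generated_Groups"
begin

(* Letters of B^{+-1}: (b, True) stands for b, (b, False) for b^{-1}. *)
type_synonym 'a letter = "'a \<times> bool"

fun linv :: "'a letter \<Rightarrow> 'a letter" where
  "linv (b, s) = (b, \<not> s)"

fun reduced :: "'a letter list \<Rightarrow> bool" where
  "reduced (x # y # ys) = (y \<noteq> linv x \<and> reduced (y # ys))"
| "reduced _ = True"

fun red :: "'a letter list \<Rightarrow> 'a letter list" where
  "red [] = []"
| "red (x # xs) = (case red xs of [] \<Rightarrow> [x]
                    | y # ys \<Rightarrow> (if y = linv x then ys else x # y # ys))"

definition FG :: "'a set \<Rightarrow> 'a letter list monoid" where
  "FG B = \<lparr> carrier = {w. fst ` set w \<subseteq> B \<and> reduced w},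
            mult = (\<lambda>x y. red (x @ y)),
            one = [] \<rparr>"

definition fg_subgroup :: "'a letter list monoid \<Rightarrow> 'a letter list set \<Rightarrow> bool" where
  "fg_subgroup G H \<longleftrightarrow> subgroup H G \<and>
     (\<exists>S. finite S \<and> S \<subseteq> carrier G \<and> H = generate G S)"

definition cyc_reduced :: "'a letter list \<Rightarrow> bool" where
  "cyc_reduced w \<longleftrightarrow> reduced w \<and> (w \<noteq> [] \<longrightarrow> hd w \<noteq> linv (last w))"

(* The covering graph of the rose R_B for H: vertices are right cosets H g,
   edges are pairs (H g, b) with b \<in> B, going from H g to H g b.
   Traversing a letter x starting at vertex H a uses this edge: *)
definition trav :: "'a letter list monoid \<Rightarrow> 'a letter list set \<Rightarrow> 'a letter list
                     \<Rightarrow> 'a letter \<Rightarrow> 'a letter list set \<times> 'a" where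
  "trav G H a x = (if snd x then (H #>\<^bsub>G\<^esub> a, fst x)
                   else (H #>\<^bsub>G\<^esub> (a \<otimes>\<^bsub>G\<^esub> [x]), fst x))"

(* Edges of the core Sigma(H): the union of all immersed loops (closed paths with
   cyclically reduced label) in the covering graph.  Reading w from vertex H g
   closes up iff g w g^{-1} \<in> H. *)
definition core_edges :: "'a letter list monoid \<Rightarrow> 'a letter list set
                            \<Rightarrow> ('a letter list set \<times> 'a) set" where
  "core_edges G H = { trav G H (g \<otimes>\<^bsub>G\<^esub> take i w) (w ! i) | g w i.
       g \<in> carrier G \<and> w \<in> carrier G \<and> w \<noteq> [] \<and> cyc_reduced w \<and>
       g \<otimes>\<^bsub>G\<^esub> w \<otimes>\<^bsub>G\<^esub> inv\<^bsub>G\<^esub> g \<in> H \<and> i < length w }"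

definition complexity :: "'a letter list monoid \<Rightarrow> 'a letter list set list \<Rightarrow> nat" where
  "complexity G Hs = (\<Sum>H\<leftarrow>Hs. card (core_edges G H))"

definition gersten_rep :: "'a letter list monoid \<Rightarrow> 'a letter list set list \<Rightarrow> bool" where
  "gersten_rep G Hs \<longleftrightarrow>
     (\<forall>\<alpha> \<in> iso G G. complexity G Hs \<le> complexity G (map (\<lambda>H. \<alpha> ` H) Hs))"

end

theory Submission
  imports Defs
begin

text \<open>
  Let \<open>\<alpha>\<close> be an automorphism of \<open>F(B)\<close> and \<open>A = \<alpha>(F(B'))\<close>.  Choose a spanning tree, that is, a
  Schreier transversal, in the covering graph of the rose corresponding to \<open>A\<close>.  The edges outside
  the tree freely generate \<open>A\<close>, so there are \<open>|B'|\<close> of them, and collapsing the tree identifies \<open>A\<close>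
  with \<open>F(B')\<close>; composing with \<open>\<alpha>\<close> gives an automorphism \<open>\<beta>\<close> of \<open>F(B')\<close>.  The graph of \<open>\<beta>(H)\<close> arises
  from that of \<open>\<alpha>(H)\<close> by collapsing the lifts of the tree, so it has at most as many edges.
  Hence minimality over \<open>B'\<close> implies minimality over \<open>B\<close>.  For the converse, automorphisms of \<open>F(B')\<close>
  extend to \<open>F(B)\<close> by the identity on \<open>B - B'\<close>, and the core graph of a subgroup of \<open>F(B')\<close> does not
  depend on the ambient basis.
\<close>

section \<open>Words and free reduction\<close>

definition winv :: "'a letter list \<Rightarrow> 'a letter list" where
  "winv w = rev (map linv w)"

lemma linv_linv [simp]: "linv (linv x) = x"
  by (cases x) simp

lemma linv_eq_iff [simp]: "linv x = linv y \<longleftrightarrow> x = y"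
  by (metis linv_linv)

lemma linv_neq [simp]: "linv x \<noteq> x" "x \<noteq> linv x"
  by (cases x; simp)+

lemma fst_linv [simp]: "fst (linv x) = fst x"
  by (cases x) simp

lemma snd_linv [simp]: "snd (linv x) = (\<not> snd x)"
  by (cases x) simp

lemma winv_simps [simp]:
  "winv [] = []" "winv (x # xs) = winv xs @ [linv x]" "winv (xs @ ys) = winv ys @ winv xs"
  "winv (winv xs) = xs" "length (winv xs) = length xs" "winv xs = [] \<longleftrightarrow> xs = []"
  "fst ` set (winv xs) = fst ` set xs"
  by (auto simp: winv_def rev_map o_def image_image)

lemma last_winv: "w \<noteq> [] \<Longrightarrow> last (winv w) = linv (hd w)"
  by (cases w) auto

lemma hd_winv: "w \<noteq> [] \<Longrightarrow> hd (winv w) = linv (last w)"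
  by (cases w rule: rev_cases) auto

lemma reduced_Cons: "reduced (x # xs) \<longleftrightarrow> reduced xs \<and> (xs = [] \<or> hd xs \<noteq> linv x)"
  by (cases xs) auto

lemma reduced_append:
  "reduced (u @ v) \<longleftrightarrow> reduced u \<and> reduced v \<and> (u = [] \<or> v = [] \<or> hd v \<noteq> linv (last u))"
  by (induction u) (auto simp: reduced_Cons)

lemma reduced_winv [simp]: "reduced (winv w) \<longleftrightarrow> reduced w"
proof -
  have "reduced (winv w)" if "reduced w" for w :: "'a letter list"
    using that by (induction w) (auto simp: reduced_Cons reduced_append last_winv)
  from this[of w] this[of "winv w"] show ?thesis by auto
qed

lemma reduced_red [simp]: "reduced (red w)"
  by (induction w) (auto split: list.splits simp: reduced_Cons)

lemma red_reduced: "reduced w \<Longrightarrow> red w = w"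
  by (induction w) (auto split: list.splits simp: reduced_Cons)

lemma red_red [simp]: "red (red w) = red w"
  by (simp add: red_reduced)

lemma length_red: "length (red w) \<le> length w"
  by (induction w) (auto split: list.splits)

lemma red_eq_self_if_length: "length (red w) = length w \<Longrightarrow> red w = w"
proof (induction w)
  case (Cons x w)
  then show ?case using length_red[of w] by (auto split: list.splits if_splits)
qed simp

lemma set_red: "set (red w) \<subseteq> set w"
  by (induction w) (fastforce split: list.splits if_splits)+

lemma red_append_right [simp]: "red (x @ red y) = red (x @ y)"
  by (induction x) auto

lemma red_Cons_right [simp]: "red (x # red y) = red (x # y)"
  using red_append_right[of "[x]" y] by (simp del: red.simps)

lemma red_cancel [simp]: "red (a # linv a # z) = red z"
proof -
  have "reduced (red z)" by simp
  then show ?thesis by (cases "red z") (auto split: list.splits simp: reduced_Cons)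
qed

lemma red_cancel' [simp]: "red (linv a # a # z) = red z"
  using red_cancel[of "linv a" z] by (simp del: red_cancel)

declare red.simps(2) [simp del]

text \<open>\<open>red\<close> works from the right, so reducing a suffix first changes nothing by
  plain induction; for a prefix one also needs that a cancelling pair may be dropped
  (\<open>red_cancel\<close>). Together the two facts give associativity of the
  multiplication.\<close>

lemma red_append_left [simp]: "red (red x @ y) = red (x @ y)"
proof (induction x)
  case (Cons a x)
  have IH: "red (a # x @ y) = red (a # red x @ y)"
    using Cons red_Cons_right by metis
  show ?case
  proof (cases "red x")
    case Nil
    then show ?thesis using IH by (simp add: red.simps(2)[of a x])
  next
    case (Cons z zs)
    then show ?thesis using IH by (auto simp: red.simps(2)[of a x])
  qed
qed simp

lemma red_append_mid [simp]: "red (x @ red y @ z) = red (x @ y @ z)"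
  by (metis red_append_left red_append_right)

lemma red_winv_cancel [simp]: "red (w @ winv w @ z) = red z"
proof (induction w arbitrary: z)
  case (Cons x w)
  have "red (x # w @ winv w @ linv x # z) = red (x # linv x # z)"
    by (metis Cons red_Cons_right)
  then show ?case by simp
qed simp

lemma red_winv_cancel' [simp]: "red (winv w @ w @ z) = red z"
  using red_winv_cancel[of "winv w" z] by (simp del: red_winv_cancel)

lemma red_winv_cancel_mid [simp]:
  "red (y @ w @ winv w @ z) = red (y @ z)" "red (y @ winv w @ w @ z) = red (y @ z)"
  by (metis red_append_right red_winv_cancel, metis red_append_right red_winv_cancel')

lemma red_winv_cancel_end [simp]:
  "red (y @ w @ winv w) = red y" "red (y @ winv w @ w) = red y"
  "red (w @ winv w) = []" "red (winv w @ w) = []"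
  using red_winv_cancel_mid[of y w "[]"] red_winv_cancel[of w "[]"] red_winv_cancel'[of w "[]"]
  by simp_all

lemma red_append_inj: "red (x @ y) = red (x @ z) \<Longrightarrow> red y = red z"
  by (metis red_append_right red_winv_cancel')

lemma winv_red: "winv (red w) = red (winv w)"
proof -
  have "red (w @ winv (red w)) = red (w @ winv w)"
    by (metis red_append_left red_winv_cancel_end(3))
  then show ?thesis by (metis red_append_inj red_reduced reduced_red reduced_winv)
qed

text \<open>All cancellation happens at the junction: a suffix \<open>c\<close> of \<open>u\<close>
  meets its inverse at the start of \<open>v\<close>. The induction on \<open>v\<close> strips one
  letter off the end of \<open>u\<close> for each letter that cancels.\<close>

lemma red_append_decomp:
  assumes "reduced u" "reduced v"
  shows "\<exists>u' c v'. u = u' @ c \<and> v = winv c @ v' \<and> red (u @ v) = u' @ v'"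
  using assms
proof (induction v arbitrary: u)
  case Nil
  then show ?case by (intro exI[of _ u] exI[of _ "[]"]) (simp add: red_reduced)
next
  case (Cons x v)
  show ?case
  proof (cases "u \<noteq> [] \<and> x = linv (last u)")
    case True
    then obtain u1 y where u: "u = u1 @ [y]" "x = linv y"
      by (cases u rule: rev_cases) auto
    obtain u' c v' where *: "u1 = u' @ c" "v = winv c @ v'" "red (u1 @ v) = u' @ v'"
      using Cons.IH[of u1] Cons.prems u by (auto simp: reduced_append reduced_Cons)
    have "red (u @ x # v) = red (u1 @ [y] @ winv [y] @ v)"
      using u by simp
    also have "\<dots> = red (u1 @ v)" by (rule red_winv_cancel_mid)
    finally show ?thesis
      using * u by (intro exI[of _ u'] exI[of _ "c @ [y]"] exI[of _ v']) simp
  next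
    case False
    then have "reduced (u @ x # v)" using Cons.prems by (auto simp: reduced_append)
    then show ?thesis
      by (intro exI[of _ u] exI[of _ "[]"] exI[of _ "x # v"]) (simp add: red_reduced)
  qed
qed

text \<open>Each letter of \<open>v\<close> can cancel at most one letter of \<open>u\<close>. With
  truncated subtraction the claim is empty when \<open>v\<close> is at least as long as
  \<open>u\<close>.\<close>

lemma red_append_keeps_prefix:
  assumes "reduced u" "reduced v"
  shows "\<exists>p. red (u @ v) = take (length u - length v) u @ p"
proof -
  obtain u' c v' where *: "u = u' @ c" "v = winv c @ v'" "red (u @ v) = u' @ v'"
    using red_append_decomp[OF assms] by blast
  then have "take (length u - length v) u = take (length u' - length v') u'" by simp
  then show ?thesis using *(3) by (metis append.assoc append_take_drop_id)
qed

section \<open>The free group\<close>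

lemma FG_simps [simp]:
  "mult (FG B) x y = red (x @ y)" "one (FG B) = []"
  by (simp_all add: FG_def)

lemma FG_carrier: "w \<in> carrier (FG B) \<longleftrightarrow> fst ` set w \<subseteq> B \<and> reduced w"
  by (simp add: FG_def)

lemma FG_carrier_mono: "B' \<subseteq> B \<Longrightarrow> carrier (FG B') \<subseteq> carrier (FG B)"
  by (auto simp: FG_def)

lemma FG_reduced: "w \<in> carrier (FG B) \<Longrightarrow> reduced w"
  by (simp add: FG_carrier)

lemma red_in_FG: "fst ` set w \<subseteq> B \<Longrightarrow> red w \<in> carrier (FG B)"
  using set_red[of w] by (auto simp: FG_carrier)

lemma winv_in_FG: "w \<in> carrier (FG B) \<Longrightarrow> winv w \<in> carrier (FG B)"
  by (simp add: FG_carrier)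

lemma group_FG: "group (FG B)"
proof (rule groupI)
  fix x assume "x \<in> carrier (FG B)"
  then show "\<exists>y\<in>carrier (FG B). y \<otimes>\<^bsub>FG B\<^esub> x = \<one>\<^bsub>FG B\<^esub>"
    by (intro bexI[of _ "winv x"]) (auto simp: winv_in_FG)
next
  fix x y assume "x \<in> carrier (FG B)" "y \<in> carrier (FG B)"
  then show "x \<otimes>\<^bsub>FG B\<^esub> y \<in> carrier (FG B)"
    using red_in_FG[of "x @ y" B] by (auto simp: FG_carrier)
qed (auto simp: FG_carrier red_reduced)

lemma inv_FG: "w \<in> carrier (FG B) \<Longrightarrow> inv\<^bsub>FG B\<^esub> w = winv w"
  by (rule group.inv_equality[OF group_FG]) (simp_all add: winv_in_FG)

lemma FG_rcos: "H #>\<^bsub>FG B\<^esub> a = (\<lambda>h. red (h @ a)) ` H"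
  by (auto simp: r_coset_def)

lemma subgroup_FGD:
  assumes "subgroup H (FG B)"
  shows "[] \<in> H" "\<And>x. x \<in> H \<Longrightarrow> winv x \<in> H" "\<And>x y. x \<in> H \<Longrightarrow> y \<in> H \<Longrightarrow> red (x @ y) \<in> H"
    "\<And>x. x \<in> H \<Longrightarrow> x \<in> carrier (FG B)"
  using subgroup.one_closed[OF assms] subgroup.m_inv_closed[OF assms] subgroup.m_closed[OF assms]
    subgroup.mem_carrier[OF assms]
  by (simp, metis inv_FG, simp_all)

lemma subgroup_FGI:
  assumes "H \<subseteq> carrier (FG B)" "[] \<in> H" "\<And>x. x \<in> H \<Longrightarrow> winv x \<in> H"
    "\<And>x y. x \<in> H \<Longrightarrow> y \<in> H \<Longrightarrow> red (x @ y) \<in> H"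
  shows "subgroup H (FG B)"
  using assms by (intro subgroup.intro) (auto simp: inv_FG)

lemma subgroup_FG_mono:
  assumes "subgroup H (FG B')" "B' \<subseteq> B"
  shows "subgroup H (FG B)"
  using subgroup_FGD[OF assms(1)] FG_carrier_mono[OF assms(2)] by (intro subgroup_FGI) auto

text \<open>Here \<open>y\<close> is an arbitrary word, reduced or not, so that cosets can be
  computed on unreduced words.\<close>

lemma rcos_absorb:
  assumes H: "subgroup H (FG B)" and h: "h \<in> H"
  shows "H #>\<^bsub>FG B\<^esub> red (h @ y) = H #>\<^bsub>FG B\<^esub> y"
proof (intro equalityI subsetI)
  fix z assume "z \<in> H #>\<^bsub>FG B\<^esub> red (h @ y)"
  then obtain k where "k \<in> H" "z = red (red (k @ h) @ y)" by (auto simp: FG_rcos)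
  then show "z \<in> H #>\<^bsub>FG B\<^esub> y"
    using subgroup_FGD(3)[OF H _ h] unfolding FG_rcos by blast
next
  fix z assume "z \<in> H #>\<^bsub>FG B\<^esub> y"
  then obtain k where k: "k \<in> H" "z = red (k @ y)" by (auto simp: FG_rcos)
  then have "z = red (red (k @ winv h) @ red (h @ y))" by simp
  then show "z \<in> H #>\<^bsub>FG B\<^esub> red (h @ y)"
    using subgroup_FGD(3)[OF H k(1) subgroup_FGD(2)[OF H h]] unfolding FG_rcos by blast
qed

text \<open>Uniqueness half of the universal property of the free group.\<close>

lemma FG_hom_eq_on_generators:
  assumes f: "f \<in> hom (FG B) G" and g: "g \<in> hom (FG B) G" and G: "group G"
    and eq: "\<And>b. b \<in> B \<Longrightarrow> f [(b, True)] = g [(b, True)]"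
    and w: "w \<in> carrier (FG B)"
  shows "f w = g w"
  using w
proof (induction w)
  case Nil
  then show ?case using hom_one[OF f group_FG G] hom_one[OF g group_FG G] by simp
next
  case (Cons x w)
  have carr: "[x] \<in> carrier (FG B)" "w \<in> carrier (FG B)"
    using Cons.prems by (auto simp: FG_carrier reduced_Cons)
  have "f [x] = g [x]"
  proof (cases x)
    case (Pair b s)
    have b: "[(b, True)] \<in> carrier (FG B)" using carr Pair by (simp add: FG_carrier)
    have x: "[(b, False)] = inv\<^bsub>FG B\<^esub> [(b, True)]" using b by (simp add: inv_FG)
    have "b \<in> B" using b by (simp add: FG_carrier)
    then show ?thesis
      using Pair eq[of b] group_hom.hom_inv[of "FG B" G f, OF _ b] group_hom.hom_inv[of "FG B" G g, OF _ b]
        f g G group_FG[of B] x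
      by (cases s) (auto simp: group_hom_def group_hom_axioms_def)
  qed
  moreover have "x # w = [x] \<otimes>\<^bsub>FG B\<^esub> w"
    using Cons.prems by (simp add: FG_carrier red_reduced)
  ultimately show ?case
    using hom_mult[OF f carr] hom_mult[OF g carr] Cons.IH[OF carr(2)] by metis
qed

section \<open>Core graphs\<close>

text \<open>Cyclic reducedness rules out cancellation between consecutive copies of
  \<open>w\<close>; the last hypothesis rules it out between \<open>g\<close> and the first
  copy.\<close>

lemma reduced_power:
  assumes "cyc_reduced w" "reduced g" "g = [] \<or> w = [] \<or> hd w \<noteq> linv (last g)"
  shows "reduced (g @ concat (replicate n w))"
proof (cases "w = []")
  case False
  have "reduced (concat (replicate n w)) \<and> (n > 0 \<longrightarrow> hd (concat (replicate n w)) = hd w)"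
    using assms(1) False
    by (induction n) (auto simp: cyc_reduced_def reduced_append hd_append)
  then show ?thesis using assms False by (cases n) (auto simp: reduced_append)
qed (use assms in simp)

lemma power_conj_in_subgroup:
  assumes "subgroup H (FG B)" "red (g @ w @ winv g) \<in> H"
  shows "red (g @ concat (replicate n w) @ winv g) \<in> H"
proof (induction n)
  case 0
  show ?case using subgroup_FGD(1)[OF assms(1)] by simp
next
  case (Suc n)
  have "red (red (g @ w @ winv g) @ red (g @ concat (replicate n w) @ winv g)) \<in> H"
    using Suc assms subgroup_FGD(3) by blast
  moreover have "red (red (g @ w @ winv g) @ red (g @ concat (replicate n w) @ winv g))
      = red ((g @ w) @ winv g @ g @ concat (replicate n w) @ winv g)" by simp
  ultimately show ?case by (simp only: red_winv_cancel_mid) simp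
qed

text \<open>A reduced path \<open>g\<close> from the base vertex to a core vertex extends to a
  reduced closed path. This ties core vertices to elements of \<open>H\<close>: it controls both the
  letters of \<open>g\<close> and the number of such vertices.\<close>

lemma core_vertex_prefix_noncancel:
  assumes H: "subgroup H (FG B)" and g: "reduced g" and w: "cyc_reduced w" "w \<noteq> []"
    and conj: "red (g @ w @ winv g) \<in> H" and nc: "g = [] \<or> hd w \<noteq> linv (last g)"
  shows "\<exists>p. g @ p \<in> H"
proof -
  \<comment> \<open>Every copy of \<open>w\<close> has at least one letter, so \<open>u\<close>
    below has length at least \<open>3 * length g\<close>. Multiplying by \<open>winv g\<close>
    deletes at most \<open>length g\<close> letters from its end, and the initial \<open>g\<close>
    survives.\<close>
  define n where "n = 2 * length g"
  define u where "u = g @ concat (replicate n w)"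
  have red_u: "reduced u" unfolding u_def using assms by (intro reduced_power) auto
  have "length u \<ge> length g + n"
    using w(2) by (cases w) (auto simp: u_def length_concat sum_list_replicate)
  then have len: "length u - length (winv g) \<ge> length g" by (simp add: n_def)
  obtain p where p: "red (u @ winv g) = take (length u - length (winv g)) u @ p"
    using red_append_keeps_prefix[OF red_u, of "winv g"] g by auto
  have "red (u @ winv g) \<in> H"
    using power_conj_in_subgroup[OF H conj, of n] by (simp add: u_def)
  then show ?thesis using p len by (auto simp: u_def)
qed

text \<open>High powers of a cyclically reduced loop, or of its inverse, leave the tail \<open>g\<close> of the
  lasso uncancelled.\<close>

lemma core_vertex_prefix:
  assumes H: "subgroup H (FG B)" and g: "reduced g" and w: "cyc_reduced w" "w \<noteq> []"
    and conj: "red (g @ w @ winv g) \<in> H"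
  shows "\<exists>p. g @ p \<in> H"
proof (cases "g = [] \<or> hd w \<noteq> linv (last g)")
  case True
  then show ?thesis using core_vertex_prefix_noncancel assms by blast
next
  case False
  have "cyc_reduced (winv w)"
    using w by (auto simp: cyc_reduced_def hd_winv last_winv)
  moreover have "red (g @ winv w @ winv g) \<in> H"
    using subgroup_FGD(2)[OF H conj] by (simp add: winv_red)
  \<comment> \<open>If both \<open>w\<close> and its inverse cancelled against the last letter of
    \<open>g\<close>, then \<open>hd w\<close> would be \<open>linv (last w)\<close>, against cyclic
    reducedness.\<close>
  moreover have "hd (winv w) \<noteq> linv (last g)"
    using False w by (auto simp: hd_winv cyc_reduced_def)
  ultimately show ?thesis
    using core_vertex_prefix_noncancel[OF H g, of "winv w"] w by simp
qed

text \<open>Normal form of a core edge: the loop is rotated until the edge comes first, and inverted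
  if it runs through the edge backwards. Then \<open>g\<close> leads to the source of the
  edge.\<close>

lemma in_core_edgesD:
  assumes H: "subgroup H (FG B)" and e: "e \<in> core_edges (FG B) H"
  obtains g w b where "e = (H #>\<^bsub>FG B\<^esub> g, b)" "g \<in> carrier (FG B)" "w \<in> carrier (FG B)"
    "cyc_reduced w" "w \<noteq> []" "hd w = (b, True)" "red (g @ w @ winv g) \<in> H"
proof -
  from e obtain g w i where e: "e = trav (FG B) H (red (g @ take i w)) (w ! i)"
    and g: "g \<in> carrier (FG B)" and w: "w \<in> carrier (FG B)" "cyc_reduced w"
    and i: "i < length w" and "g \<otimes>\<^bsub>FG B\<^esub> w \<otimes>\<^bsub>FG B\<^esub> inv\<^bsub>FG B\<^esub> g \<in> H"
    by (auto simp: core_edges_def)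
  then have conj: "red (g @ w @ winv g) \<in> H" by (simp add: inv_FG)
  \<comment> \<open>\<open>x # r\<close> is the rotation of \<open>w\<close> that starts at position
    \<open>i\<close>; it is read from the vertex that \<open>g1\<close> reaches.\<close>
  define g1 where "g1 = red (g @ take i w)"
  define r where "r = drop (Suc i) w @ take i w"
  define x where "x = w ! i"
  have w_split: "w = take i w @ x # drop (Suc i) w"
    using i by (simp add: x_def id_take_nth_drop)
  have cyc: "cyc_reduced (x # r)"
  proof -
    have "cyc_reduced (p @ x # q) \<Longrightarrow> cyc_reduced (x # q @ p)" for p q
      by (cases "p = []"; cases "q = []")
        (auto simp: cyc_reduced_def reduced_append reduced_Cons hd_append)
    then show ?thesis using w(2) w_split r_def by metis
  qed
  have sets: "set w = set (x # r)"
    by (subst w_split) (auto simp: r_def)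
  have xr: "x # r \<in> carrier (FG B)"
    using cyc w(1) sets by (auto simp: FG_carrier cyc_reduced_def)
  have g1: "g1 \<in> carrier (FG B)"
  proof -
    have "fst ` set (take i w) \<subseteq> B"
      using w(1) image_mono[OF set_take_subset[of i w], of fst] by (simp add: FG_carrier) blast
    then show ?thesis
      unfolding g1_def using g by (intro red_in_FG) (simp add: FG_carrier image_Un)
  qed
  have "red (g1 @ (x # r) @ winv g1) = red (g @ take i w @ x # r @ winv (take i w) @ winv g)"
    using red_append_right[of "g @ take i w @ x # r" "winv (take i w) @ winv g"]
    by (simp add: g1_def winv_red)
  also have "\<dots> = red ((g @ w) @ take i w @ winv (take i w) @ winv g)"
    by (subst (3) w_split) (simp add: r_def)
  finally have conj1: "red (g1 @ (x # r) @ winv g1) \<in> H"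
    using conj by (simp only: red_winv_cancel_mid) simp
  show thesis
  proof (cases "snd x")
    case True
    show thesis
      by (rule that[of g1 "fst x" "x # r"])
        (use e g1 xr cyc conj1 True in \<open>auto simp: trav_def x_def g1_def prod_eq_iff\<close>)
  next
    case False
    \<comment> \<open>The source of the edge in its positive orientation is the far end of
      \<open>x\<close>. The loop \<open>u\<close> is the inverse loop, rotated to start there with
      \<open>linv x\<close>.\<close>
    define g2 where "g2 = red (g1 @ [x])"
    define u where "u = linv x # winv r"
    have "red (g2 @ u @ winv g2) = red (g1 @ [x] @ winv [x] @ winv r @ winv [x] @ winv g1)"
      using red_append_right[of "g1 @ x # linv x # winv r" "linv x # winv g1"]
      by (simp add: g2_def u_def winv_red)
    also have "\<dots> = winv (red (g1 @ (x # r) @ winv g1))"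
      by (subst red_winv_cancel_mid) (simp add: winv_red)
    finally have "red (g2 @ u @ winv g2) \<in> H"
      using subgroup_FGD(2)[OF H conj1] by simp
    moreover have "cyc_reduced u"
      using cyc by (auto simp: u_def cyc_reduced_def reduced_Cons hd_winv last_winv)
    moreover have "u \<in> carrier (FG B)"
      using \<open>cyc_reduced u\<close> xr by (simp add: FG_carrier cyc_reduced_def u_def)
    moreover have "g2 \<in> carrier (FG B)"
      unfolding g2_def using g1 xr by (intro red_in_FG) (auto simp: FG_carrier)
    ultimately show thesis
      by (intro that[of g2 "fst x" u])
        (use e False in \<open>auto simp: trav_def x_def g1_def g2_def u_def prod_eq_iff\<close>)
  qed
qed

lemma in_core_edgesI:
  assumes "g \<in> carrier (FG B)" "w \<in> carrier (FG B)" "cyc_reduced w" "w \<noteq> []"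
    "hd w = (b, True)" "red (g @ w @ winv g) \<in> H"
  shows "(H #>\<^bsub>FG B\<^esub> g, b) \<in> core_edges (FG B) H"
proof -
  have "(H #>\<^bsub>FG B\<^esub> g, b) = trav (FG B) H (g \<otimes>\<^bsub>FG B\<^esub> take 0 w) (w ! 0)"
    using assms by (simp add: trav_def hd_conv_nth FG_carrier red_reduced)
  moreover have "g \<otimes>\<^bsub>FG B\<^esub> w \<otimes>\<^bsub>FG B\<^esub> inv\<^bsub>FG B\<^esub> g \<in> H"
    using assms by (simp add: inv_FG)
  ultimately show ?thesis
    unfolding core_edges_def using assms by blast
qed

text \<open>A core vertex \<open>g\<close> extends to an element of \<open>H\<close>, which has
  letters in \<open>B'\<close> only; so \<open>g\<close> lies in the smaller group, and so does
  \<open>w\<close>, a conjugate by \<open>g\<close> of an element of \<open>H\<close>. The two edge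
  sets are literally equal because a coset, as a set of words, does not mention the basis.\<close>

lemma core_edges_FG_mono:
  assumes H: "subgroup H (FG B')" and B: "B' \<subseteq> B"
  shows "core_edges (FG B') H = core_edges (FG B) H"
proof (intro equalityI subsetI)
  fix e assume "e \<in> core_edges (FG B') H"
  from in_core_edgesD[OF H this] obtain g w b where
    e: "e = (H #>\<^bsub>FG B'\<^esub> g, b)" and g: "g \<in> carrier (FG B')" and w: "w \<in> carrier (FG B')"
    "cyc_reduced w" "w \<noteq> []" "hd w = (b, True)" and conj: "red (g @ w @ winv g) \<in> H" .
  then show "e \<in> core_edges (FG B) H"
    using in_core_edgesI[OF _ _ w(2-4) conj, of B] FG_carrier_mono[OF B] by (auto simp: FG_rcos)
next
  fix e assume e: "e \<in> core_edges (FG B) H"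
  have H': "subgroup H (FG B)" using subgroup_FG_mono[OF H B] .
  from in_core_edgesD[OF H' e] obtain g w b where
    e: "e = (H #>\<^bsub>FG B\<^esub> g, b)" and g: "g \<in> carrier (FG B)" and w: "w \<in> carrier (FG B)"
    "cyc_reduced w" "w \<noteq> []" "hd w = (b, True)" and conj: "red (g @ w @ winv g) \<in> H" .
  obtain p where "g @ p \<in> H"
    using core_vertex_prefix[OF H' FG_reduced[OF g] w(2,3) conj] by blast
  then have g': "g \<in> carrier (FG B')"
    using subgroup_FGD(4)[OF H] by (force simp: FG_carrier reduced_append)
  have "w = red (winv g @ red (g @ w @ winv g) @ g)"
    using w(1) by (simp add: FG_carrier red_reduced)
  also have "\<dots> \<in> carrier (FG B')"
    using subgroup_FGD(4)[OF H conj] g'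
    by (intro red_in_FG) (simp add: FG_carrier image_Un)
  finally have "w \<in> carrier (FG B')" .
  then show "e \<in> core_edges (FG B') H"
    using in_core_edgesI[OF g' _ w(2-4) conj] e by (simp add: FG_rcos)
qed

text \<open>Closed paths spelled by products of generators visit only vertices on the loops of the
  generators. A prefix of the reduced product of \<open>h1\<close> and \<open>h2\<close> either lies
  within \<open>h1\<close>, or leads to the same coset as a prefix of \<open>h2\<close>, since
  \<open>h1\<close> itself is absorbed.\<close>

lemma generate_prefix_cosets:
  assumes S: "S \<subseteq> carrier (FG B)" and h: "h \<in> generate (FG B) S" and hp: "h = p @ q"
  shows "\<exists>s\<in>S \<union> winv ` S \<union> {[]}. \<exists>r q. s = r @ q \<and>
    generate (FG B) S #>\<^bsub>FG B\<^esub> p = generate (FG B) S #>\<^bsub>FG B\<^esub> r"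
  using h hp
proof (induction arbitrary: p q)
  case one
  then show ?case by auto
next
  case (incl h)
  then show ?case by blast
next
  case (inv h)
  then have "winv h = p @ q" using S by (metis inv_FG subsetD)
  then show ?case using inv(1) by blast
next
  case (eng h1 h2)
  have sub: "subgroup (generate (FG B) S) (FG B)"
    using group.generate_is_subgroup[OF group_FG S] .
  have "reduced h1" "reduced h2"
    using eng(1,2) subgroup_FGD(4)[OF sub] by (auto simp: FG_carrier)
  then obtain u' c v' where *: "h1 = u' @ c" "h2 = winv c @ v'" "red (h1 @ h2) = u' @ v'"
    using red_append_decomp by blast
  have "u' @ v' = p @ q" using * eng.prems by simp
  then consider r where "u' = p @ r" | r where "v' = r @ q" "p = u' @ r"
    by (auto simp: append_eq_append_conv2)
  then show ?case
  proof cases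
    case 1
    then show ?thesis using eng.IH(1)[of p "r @ c"] * by simp
  next
    case 2
    have "reduced p" using 2 * by (metis append.assoc reduced_append reduced_red)
    then have "p = red (h1 @ winv c @ r)"
      using 2 * by (simp add: red_reduced)
    then have "generate (FG B) S #>\<^bsub>FG B\<^esub> p = generate (FG B) S #>\<^bsub>FG B\<^esub> (winv c @ r)"
      using rcos_absorb[OF sub eng(1)] by simp
    then show ?thesis using eng.IH(2)[of "winv c @ r" q] 2 * by simp
  qed
qed

text \<open>Core vertices are cosets of prefixes of elements of \<open>H\<close>, hence of prefixes
  of finitely many generators and inverses. Finiteness is what lets \<open>card\<close> be compared
  along a surjection, as \<open>card\<close> of an infinite set is 0.\<close>

lemma finite_core_edges:
  assumes H: "fg_subgroup (FG B) H" and B: "finite B"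
  shows "finite (core_edges (FG B) H)"
proof -
  from H obtain S where S: "finite S" "S \<subseteq> carrier (FG B)" "H = generate (FG B) S"
    and sub: "subgroup H (FG B)"
    by (auto simp: fg_subgroup_def)
  define V where "V = (\<Union>s\<in>S \<union> winv ` S \<union> {[]}. (\<lambda>n. H #>\<^bsub>FG B\<^esub> take n s) ` {..length s})"
  have "finite V" using S by (auto simp: V_def)
  have "core_edges (FG B) H \<subseteq> V \<times> B"
  proof
    fix e assume "e \<in> core_edges (FG B) H"
    from in_core_edgesD[OF sub this] obtain g w b where
      e: "e = (H #>\<^bsub>FG B\<^esub> g, b)" and g: "g \<in> carrier (FG B)" and w: "w \<in> carrier (FG B)"
      "cyc_reduced w" "w \<noteq> []" "hd w = (b, True)" and conj: "red (g @ w @ winv g) \<in> H" .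
    obtain p where "g @ p \<in> H"
      using core_vertex_prefix[OF sub FG_reduced[OF g] w(2,3) conj] by blast
    then obtain s r q where s: "s \<in> S \<union> winv ` S \<union> {[]}" "s = r @ q"
      and r: "H #>\<^bsub>FG B\<^esub> g = H #>\<^bsub>FG B\<^esub> r"
      using generate_prefix_cosets[OF S(2), of "g @ p" g p] S(3) by auto
    have "H #>\<^bsub>FG B\<^esub> g \<in> V"
      unfolding V_def r by (intro UN_I[OF s(1)] image_eqI[of _ _ "length r"]) (auto simp: s)
    moreover have "b \<in> B"
      using w by (cases w) (auto simp: FG_carrier)
    ultimately show "e \<in> V \<times> B" using e by simp
  qed
  then show ?thesis using \<open>finite V\<close> B by (meson finite_SigmaI finite_subset)
qed

section \<open>Rank\<close>

text \<open>The homomorphism to the group of order two that is nontrivial exactly on the generators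
  in \<open>S\<close>; a letter and its inverse count alike modulo 2.\<close>

definition odd_in :: "'a set \<Rightarrow> 'a letter list \<Rightarrow> bool" where
  "odd_in S w \<longleftrightarrow> odd (length (filter (\<lambda>x. fst x \<in> S) w))"

lemma odd_in_append: "odd_in S (u @ v) \<longleftrightarrow> odd_in S u \<noteq> odd_in S v"
  by (simp add: odd_in_def)

lemma odd_in_red: "odd_in S (red w) = odd_in S w"
proof (induction w)
  case (Cons x w)
  then show ?case
    by (auto simp: odd_in_def red.simps(2) split: list.splits)
qed simp

text \<open>Homomorphisms to the group of order two determine the rank.\<close>

lemma card_le_if_FG_surj:
  fixes B :: "'a set" and X :: "'b set"
  assumes f: "f \<in> hom (FG B) (FG X)" and surj: "f ` carrier (FG B) = carrier (FG X)"
    and fin: "finite B"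
  shows "finite X" "card X \<le> card B"
proof -
  \<comment> \<open>The homomorphism attached to \<open>S\<close> is pulled back along
    \<open>f\<close> and recorded as the set of generators in \<open>B\<close> where it is
    nontrivial. As \<open>f\<close> is onto, the pullback determines \<open>S\<close>, which gives
    an injection from \<open>Pow X\<close> into \<open>Pow B\<close>.\<close>
  define \<Theta> where "\<Theta> S = {b \<in> B. odd_in S (f [(b, True)])}" for S
  define Z :: "bool monoid" where "Z = \<lparr> carrier = UNIV, mult = (\<lambda>x y. x \<noteq> y), one = False \<rparr>"
  have Z: "group Z"
    by (rule groupI) (auto simp: Z_def)
  have hom: "(\<lambda>w. odd_in S (f w)) \<in> hom (FG B) Z" for S
  proof (rule homI)
    fix u v assume "u \<in> carrier (FG B)" "v \<in> carrier (FG B)"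
    then have "f (u \<otimes>\<^bsub>FG B\<^esub> v) = red (f u @ f v)" using hom_mult[OF f] by simp
    then show "odd_in S (f (u \<otimes>\<^bsub>FG B\<^esub> v)) = odd_in S (f u) \<otimes>\<^bsub>Z\<^esub> odd_in S (f v)"
      by (simp only: odd_in_red odd_in_append) (simp add: Z_def)
  qed (simp add: Z_def)
  have "inj_on \<Theta> (Pow X)"
  proof (rule inj_onI)
    fix S S' assume S: "S \<in> Pow X" "S' \<in> Pow X" and eq: "\<Theta> S = \<Theta> S'"
    have *: "odd_in S (f w) = odd_in S' (f w)" if "w \<in> carrier (FG B)" for w
    proof (rule FG_hom_eq_on_generators[OF hom[of S] hom[of S'] Z _ that])
      fix b assume "b \<in> B"
      then show "odd_in S (f [(b, True)]) = odd_in S' (f [(b, True)])"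
        using eq by (auto simp: \<Theta>_def set_eq_iff)
    qed
    have "x \<in> S \<longleftrightarrow> x \<in> S'" if "x \<in> X" for x
    proof -
      have "[(x, True)] \<in> f ` carrier (FG B)" using that by (simp add: surj FG_carrier)
      then have "odd_in S [(x, True)] = odd_in S' [(x, True)]" using * by auto
      then show ?thesis by (simp add: odd_in_def split: if_splits)
    qed
    then show "S = S'" using S by blast
  qed
  moreover have sub: "\<Theta> ` Pow X \<subseteq> Pow B" by (auto simp: \<Theta>_def)
  ultimately have "finite (Pow X)" using fin by (meson finite_Pow_iff finite_imageD finite_subset)
  then show "finite X" by simp
  then have "2 ^ card X \<le> (2 :: nat) ^ card B"
    using card_inj_on_le[OF \<open>inj_on \<Theta> (Pow X)\<close> sub] fin by (simp add: card_Pow)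
  then show "card X \<le> card B" by simp
qed

lemma FG_iso_bij_betw:
  fixes B :: "'a set" and X :: "'b set"
  assumes f: "f \<in> iso (FG B) (FG X)" and fin: "finite B"
  shows "\<exists>h. bij_betw h X B"
proof -
  have X: "finite X" "card X \<le> card B"
    using card_le_if_FG_surj[of f B X] f fin by (auto simp: iso_def bij_betw_def)
  have "inv_into (carrier (FG B)) f \<in> iso (FG X) (FG B)"
    using group.iso_set_sym[OF group_FG f] .
  then have "card B \<le> card X"
    using card_le_if_FG_surj[of _ X B] X by (auto simp: iso_def bij_betw_def)
  then show ?thesis using X fin by (simp add: finite_same_card_bij)
qed

section \<open>Extending automorphisms\<close>

definition word_map :: "('a letter \<Rightarrow> 'b letter list) \<Rightarrow> 'a letter list \<Rightarrow> 'b letter list" where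
  "word_map \<eta> w = red (concat (map \<eta> w))"

text \<open>A cancelling pair of letters goes to a word followed by its inverse. The hypothesis
  speaks of the letters of \<open>w\<close> only, so \<open>\<eta>\<close> may be arbitrary off the
  basis.\<close>

lemma word_map_red:
  assumes "\<And>x. x \<in> set w \<Longrightarrow> \<eta> (linv x) = winv (\<eta> x)"
  shows "word_map \<eta> (red w) = word_map \<eta> w"
  using assms
proof (induction w)
  case (Cons x w)
  have IH: "red (concat (map \<eta> (red w))) = red (concat (map \<eta> w))"
    using Cons by (simp add: word_map_def)
  show ?case
  proof (cases "\<exists>ys. red w = linv x # ys")
    case True
    then obtain ys where ys: "red w = linv x # ys" by blast
    have "red (\<eta> x @ concat (map \<eta> w)) = red (\<eta> x @ concat (map \<eta> (red w)))"
      by (metis IH red_append_right)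
    also have "\<dots> = red (concat (map \<eta> ys))"
      using ys Cons.prems[of x] by simp
    finally show ?thesis using ys by (simp add: word_map_def red.simps(2)[of x w])
  next
    case False
    then have "red (x # w) = x # red w"
      by (auto simp: red.simps(2)[of x w] split: list.splits)
    then show ?thesis using IH by (simp add: word_map_def) (metis red_append_right)
  qed
qed simp

text \<open>Existence half of the universal property of the free group.\<close>

lemma word_map_hom:
  assumes inv: "\<And>x. fst x \<in> B \<Longrightarrow> \<eta> (linv x) = winv (\<eta> x)"
    and carr: "\<And>x. fst x \<in> B \<Longrightarrow> \<eta> x \<in> carrier (FG C)"
  shows "word_map \<eta> \<in> hom (FG B) (FG C)"
proof (rule homI)
  fix w assume "w \<in> carrier (FG B)"
  then show "word_map \<eta> w \<in> carrier (FG C)"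
    unfolding word_map_def using carr by (intro red_in_FG) (fastforce simp: FG_carrier)
next
  fix u v assume "u \<in> carrier (FG B)" "v \<in> carrier (FG B)"
  then have "word_map \<eta> (red (u @ v)) = word_map \<eta> (u @ v)"
    using inv by (intro word_map_red) (force simp: FG_carrier)
  then show "word_map \<eta> (u \<otimes>\<^bsub>FG B\<^esub> v) = word_map \<eta> u \<otimes>\<^bsub>FG C\<^esub> word_map \<eta> v"
    by (simp add: word_map_def)
qed

definition extend_hom :: "'a set \<Rightarrow> ('a letter list \<Rightarrow> 'a letter list) \<Rightarrow> 'a letter list \<Rightarrow> 'a letter list"
  where "extend_hom B' \<beta> = word_map (\<lambda>x. if fst x \<in> B' then \<beta> [x] else [x])"

context
  fixes B B' :: "'a set"
  assumes sub: "B' \<subseteq> B"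
begin

lemma extend_hom_hom:
  assumes \<beta>: "\<beta> \<in> hom (FG B') (FG B')"
  shows "extend_hom B' \<beta> \<in> hom (FG B) (FG B)"
  unfolding extend_hom_def
proof (rule word_map_hom)
  fix x :: "'a letter" assume x: "fst x \<in> B"
  have gh: "group_hom (FG B') (FG B') \<beta>"
    using \<beta> group_FG by (auto simp: group_hom_def group_hom_axioms_def)
  have "\<beta> [linv x] = winv (\<beta> [x])" if "fst x \<in> B'"
  proof -
    have "[x] \<in> carrier (FG B')" using that by (simp add: FG_carrier)
    then show ?thesis
      using group_hom.hom_inv[OF gh, of "[x]"] hom_in_carrier[OF \<beta>] by (simp add: inv_FG)
  qed
  then show "(if fst (linv x) \<in> B' then \<beta> [linv x] else [linv x]) =
      winv (if fst x \<in> B' then \<beta> [x] else [x])" by simp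
  show "(if fst x \<in> B' then \<beta> [x] else [x]) \<in> carrier (FG B)"
    using x hom_in_carrier[OF \<beta>, of "[x]"] sub by (simp add: FG_carrier) blast
qed

lemma extend_hom_extends:
  assumes \<beta>: "\<beta> \<in> hom (FG B') (FG B')" and w: "w \<in> carrier (FG B')"
  shows "extend_hom B' \<beta> w = \<beta> w"
proof -
  have 1: "extend_hom B' \<beta> \<in> hom (FG B') (FG B)"
    using extend_hom_hom[OF \<beta>] FG_carrier_mono[OF sub] by (fastforce simp: hom_def)
  have 2: "\<beta> \<in> hom (FG B') (FG B)"
    using \<beta> FG_carrier_mono[OF sub] by (fastforce simp: hom_def)
  show ?thesis
  proof (rule FG_hom_eq_on_generators[OF 1 2 group_FG _ w])
    fix b assume "b \<in> B'"
    then have "[(b, True)] \<in> carrier (FG B')" by (simp add: FG_carrier)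
    then have "\<beta> [(b, True)] \<in> carrier (FG B')" using hom_in_carrier[OF \<beta>] by blast
    then show "extend_hom B' \<beta> [(b, True)] = \<beta> [(b, True)]"
      using \<open>b \<in> B'\<close> by (simp add: extend_hom_def word_map_def red_reduced FG_carrier)
  qed
qed

text \<open>The composite is an endomorphism of the larger group, so generators suffice: those in
  \<open>B'\<close> return by hypothesis, and the others are fixed by both extensions.\<close>

lemma extend_hom_inverse:
  assumes \<beta>: "\<beta> \<in> hom (FG B') (FG B')" and \<gamma>: "\<gamma> \<in> hom (FG B') (FG B')"
    and inv: "\<And>w. w \<in> carrier (FG B') \<Longrightarrow> \<gamma> (\<beta> w) = w" and w: "w \<in> carrier (FG B)"
  shows "extend_hom B' \<gamma> (extend_hom B' \<beta> w) = w"
proof -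
  have 1: "extend_hom B' \<gamma> \<circ> extend_hom B' \<beta> \<in> hom (FG B) (FG B)"
    using hom_compose[OF extend_hom_hom extend_hom_hom] \<beta> \<gamma> .
  have 2: "(\<lambda>w. w) \<in> hom (FG B) (FG B)" by (simp add: hom_def)
  have "(extend_hom B' \<gamma> \<circ> extend_hom B' \<beta>) w = (\<lambda>w. w) w"
  proof (rule FG_hom_eq_on_generators[OF 1 2 group_FG _ w])
    fix b assume b: "b \<in> B"
    show "(extend_hom B' \<gamma> \<circ> extend_hom B' \<beta>) [(b, True)] = [(b, True)]"
    proof (cases "b \<in> B'")
      case True
      then have "[(b, True)] \<in> carrier (FG B')" by (simp add: FG_carrier)
      moreover from this have "\<beta> [(b, True)] \<in> carrier (FG B')" using hom_in_carrier[OF \<beta>] by blast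
      ultimately show ?thesis using extend_hom_extends \<beta> \<gamma> inv by simp
    next
      case False
      then show ?thesis by (simp add: extend_hom_def word_map_def red_reduced)
    qed
  qed
  then show ?thesis by simp
qed

lemma extend_hom_iso:
  assumes \<beta>: "\<beta> \<in> iso (FG B') (FG B')"
  shows "extend_hom B' \<beta> \<in> iso (FG B) (FG B)"
proof -
  define \<gamma> where "\<gamma> = inv_into (carrier (FG B')) \<beta>"
  have \<gamma>: "\<gamma> \<in> iso (FG B') (FG B')"
    unfolding \<gamma>_def using group.iso_set_sym[OF group_FG \<beta>] .
  have homs: "\<beta> \<in> hom (FG B') (FG B')" "\<gamma> \<in> hom (FG B') (FG B')"
    using \<beta> \<gamma> by (auto simp: iso_def)
  have inv: "\<gamma> (\<beta> w) = w" "\<beta> (\<gamma> w) = w" if "w \<in> carrier (FG B')" for w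
    using \<beta> that by (auto simp: \<gamma>_def iso_def bij_betw_def f_inv_into_f)
  have "bij_betw (extend_hom B' \<beta>) (carrier (FG B)) (carrier (FG B))"
  proof (rule bij_betw_byWitness[where f' = "extend_hom B' \<gamma>"])
    show "\<forall>w\<in>carrier (FG B). extend_hom B' \<gamma> (extend_hom B' \<beta> w) = w"
      "\<forall>w\<in>carrier (FG B). extend_hom B' \<beta> (extend_hom B' \<gamma> w) = w"
      using extend_hom_inverse[OF homs inv(1)] extend_hom_inverse[OF homs(2,1) inv(2)] by simp_all
    show "extend_hom B' \<beta> ` carrier (FG B) \<subseteq> carrier (FG B)"
      "extend_hom B' \<gamma> ` carrier (FG B) \<subseteq> carrier (FG B)"
      using hom_in_carrier[OF extend_hom_hom] homs by auto
  qed
  then show ?thesis using extend_hom_hom[OF homs(1)] by (simp add: iso_def)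
qed

end

section \<open>Schreier transversals\<close>

lemma rcos_rcos: "(H #>\<^bsub>FG B\<^esub> u) #>\<^bsub>FG B\<^esub> v = H #>\<^bsub>FG B\<^esub> (u @ v)"
  by (auto simp: FG_rcos image_image)

lemma rcos_red: "H #>\<^bsub>FG B\<^esub> red u = H #>\<^bsub>FG B\<^esub> u"
  by (simp add: FG_rcos)

text \<open>The label map \<open>lab\<close> names the edges outside the spanning tree.  It is a parameter because
  the number of these edges is known only once the subgroup is known to be free on them.\<close>

locale schreier =
  fixes B :: "'a set" and A :: "'a letter list set"
    and t :: "'a letter list set \<Rightarrow> 'a letter list" and lab :: "'a letter list set \<times> 'a \<Rightarrow> 'c"
  assumes A: "subgroup A (FG B)"
    and t_mem: "v \<in> rcosets\<^bsub>FG B\<^esub> A \<Longrightarrow> t v \<in> v"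
    and t_base: "t A = []"
    and t_step: "v \<in> rcosets\<^bsub>FG B\<^esub> A \<Longrightarrow> v \<noteq> A \<Longrightarrow>
      \<exists>v' x. v' \<in> rcosets\<^bsub>FG B\<^esub> A \<and> fst x \<in> B \<and> v' #>\<^bsub>FG B\<^esub> [x] = v \<and> t v = t v' @ [x]"
    and lab: "inj_on lab {(v, b). v \<in> rcosets\<^bsub>FG B\<^esub> A \<and> b \<in> B \<and>
      t (v #>\<^bsub>FG B\<^esub> [(b, True)]) \<noteq> red (t v @ [(b, True)])}"
begin

abbreviation (input) V where "V \<equiv> rcosets\<^bsub>FG B\<^esub> A"

abbreviation act (infixl "\<rhd>" 70) where "v \<rhd> w \<equiv> v #>\<^bsub>FG B\<^esub> w"

text \<open>Because of \<open>red\<close>, one equation covers both ways in which an edge can belong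
  to the tree: the target's representative extends the source's by \<open>b\<close>, or the source's
  extends the target's by the inverse of \<open>b\<close>.\<close>

definition tree :: "'a letter list set \<Rightarrow> 'a \<Rightarrow> bool" where
  "tree v b \<longleftrightarrow> t (v \<rhd> [(b, True)]) = red (t v @ [(b, True)])"

text \<open>The edges outside the spanning tree; they index a free basis of
  \<open>A\<close>.\<close>

definition X :: "('a letter list set \<times> 'a) set" where
  "X = {(v, b). v \<in> V \<and> b \<in> B \<and> \<not> tree v b}"

text \<open>An edge is named by its start in the positive orientation, which for an inverse letter
  is the vertex where the step ends.\<close>

definition src :: "'a letter list set \<Rightarrow> 'a letter \<Rightarrow> 'a letter list set" where
  "src v x = (if snd x then v else v \<rhd> [x])"

definition emit :: "'a letter list set \<Rightarrow> 'a letter \<Rightarrow> 'c letter list" where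
  "emit v x = (if tree (src v x) (fst x) then [] else [(lab (src v x, fst x), snd x)])"

text \<open>Reidemeister-Schreier rewriting: the label of the path \<open>w\<close> from
  \<open>v\<close> after the tree has been collapsed.\<close>

fun rho :: "'a letter list set \<Rightarrow> 'a letter list \<Rightarrow> 'c letter list" where
  "rho v [] = []"
| "rho v (x # w) = emit v x @ rho (v \<rhd> [x]) w"

section \<open>The action of words on cosets, and single steps in the tree\<close>

lemma lab_inj: "inj_on lab X"
  using lab by (simp add: X_def tree_def)

lemma V_E:
  assumes "v \<in> V"
  obtains g where "g \<in> carrier (FG B)" "v = A \<rhd> g"
  using assms by (auto simp: RCOSETS_def)

lemma V_I: "fst ` set w \<subseteq> B \<Longrightarrow> A \<rhd> w \<in> V"
  using red_in_FG[of w B] rcos_red[of B A w] by (auto simp: RCOSETS_def)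

lemma A_act: "a \<in> A \<Longrightarrow> A \<rhd> a = A"
  using group.coset_join2[OF group_FG _ A] subgroup_FGD(4)[OF A] by blast

lemma A_in_V: "A \<in> V"
  using V_I[of "[]"] A_act[OF subgroup_FGD(1)[OF A]] by simp

lemma V_act: "v \<in> V \<Longrightarrow> fst ` set w \<subseteq> B \<Longrightarrow> v \<rhd> w \<in> V"
  using V_I by (elim V_E) (simp add: rcos_rcos FG_carrier image_Un)

lemma act_Nil: "v \<in> V \<Longrightarrow> v \<rhd> [] = v"
  by (erule V_E) (simp add: rcos_rcos)

lemma act_inv: "v \<in> V \<Longrightarrow> v \<rhd> [x] \<rhd> [linv x] = v"
  using rcos_red[of B v "[x, linv x]"] by (simp add: rcos_rcos act_Nil)

lemma V_carrier: "v \<in> V \<Longrightarrow> g \<in> v \<Longrightarrow> g \<in> carrier (FG B)"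
  using subgroup.rcosets_carrier[OF A group_FG] by blast

lemma V_repr:
  assumes "v \<in> V" "g \<in> v" shows "v = A \<rhd> g"
proof -
  obtain g0 where g0: "v = A \<rhd> g0" using assms(1) V_E by blast
  then obtain a where "a \<in> A" "g = red (a @ g0)" using assms by (auto simp: FG_rcos)
  then show ?thesis using rcos_absorb[OF A] g0 by metis
qed

lemma t_carrier: "v \<in> V \<Longrightarrow> t v \<in> carrier (FG B)"
  using V_carrier t_mem by blast

lemma t_repr: "v \<in> V \<Longrightarrow> A \<rhd> t v = v"
  using V_repr t_mem by metis

lemma src_V: "v \<in> V \<Longrightarrow> fst x \<in> B \<Longrightarrow> src v x \<in> V"
  by (auto simp: src_def intro!: V_act)

lemma emit_inv:
  assumes "v \<in> V"
  shows "emit (v \<rhd> [x]) (linv x) = winv (emit v x)"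
  using act_inv[OF assms, of x] by (cases x) (auto simp: emit_def src_def)

text \<open>A silent step is a tree edge, and along it the representatives follow the path in either
  direction; for an inverse letter the defining equation is solved by cancellation.\<close>

lemma emit_Nil:
  assumes v: "v \<in> V" and x: "fst x \<in> B" and e: "emit v x = []"
  shows "red (t v @ [x]) = t (v \<rhd> [x])"
proof (cases "snd x")
  case True
  then have "x = (fst x, True)" by (simp add: prod_eq_iff)
  then show ?thesis using e True by (metis emit_def src_def tree_def list.distinct(1))
next
  case False
  define y where "y = linv x"
  then have xy: "x = linv y" and y: "y = (fst x, True)" using False by (auto simp: prod_eq_iff)
  have "tree (v \<rhd> [x]) (fst x)"
    using e False by (auto simp: emit_def src_def split: if_splits)
  then have *: "t v = red (t (v \<rhd> [x]) @ [y])"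
    using act_inv[OF v, of x] by (simp add: tree_def y flip: y_def)
  have "red (t v @ [x]) = red (t (v \<rhd> [x]) @ [y] @ winv [y])"
    by (subst *) (simp add: xy)
  also have "\<dots> = t (v \<rhd> [x])"
    using t_carrier[OF V_act[OF v, of "[x]"]] x
    by (simp only: red_winv_cancel_end) (simp add: FG_carrier red_reduced)
  finally show ?thesis .
qed

lemma emit_tree:
  assumes v: "v \<in> V" and x: "fst x \<in> B" and e: "t (v \<rhd> [x]) = t v @ [x]"
  shows "emit v x = []"
proof -
  have vx: "v \<rhd> [x] \<in> V" using V_act[OF v, of "[x]"] x by simp
  have "tree (src v x) (fst x)"
  proof (cases "snd x")
    case True
    then have "x = (fst x, True)" by (simp add: prod_eq_iff)
    then show ?thesis
      using e True t_carrier[OF vx] by (metis FG_carrier red_reduced src_def tree_def)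
  next
    case False
    then have y: "linv x = (fst x, True)" by (simp add: prod_eq_iff)
    have "red (t (v \<rhd> [x]) @ [linv x]) = red (t v @ [x] @ winv [x])" by (simp add: e)
    also have "\<dots> = t v"
      using t_carrier[OF v] by (simp only: red_winv_cancel_end) (simp add: FG_carrier red_reduced)
    finally show ?thesis
      using False act_inv[OF v, of x] y by (simp add: tree_def src_def)
  qed
  then show ?thesis by (simp add: emit_def)
qed

section \<open>Rewriting along paths\<close>

lemma rho_append:
  "v \<in> V \<Longrightarrow> fst ` set u \<subseteq> B \<Longrightarrow> rho v (u @ w) = rho v u @ rho (v \<rhd> u) w"
proof (induction u arbitrary: v)
  case (Cons x u)
  then have "v \<rhd> [x] \<in> V" using V_act[of v "[x]"] by simp
  with Cons show ?case by (simp add: rcos_rcos)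
qed (simp add: act_Nil)

lemma rho_winv:
  assumes "v \<in> V" "fst ` set w \<subseteq> B"
  shows "rho (v \<rhd> w) (winv w) = winv (rho v w)"
  using assms
proof (induction w arbitrary: v)
  case (Cons x w)
  have v': "v \<rhd> [x] \<in> V" "v \<rhd> [x] \<rhd> w \<in> V"
    using Cons.prems V_act[of v "[x]"] V_act[of v "x # w"] by (auto simp: rcos_rcos)
  have "v \<rhd> [x] \<rhd> w \<rhd> winv w = v \<rhd> [x]"
    using rcos_red[of B "v \<rhd> [x]" "w @ winv w"] act_Nil[OF v'(1)]
    by (simp only: rcos_rcos red_winv_cancel_end append_assoc)
  then have "rho (v \<rhd> [x] \<rhd> w) (winv w @ [linv x]) = winv (rho (v \<rhd> [x]) w) @ emit (v \<rhd> [x]) (linv x)"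
    using rho_append[OF v'(2), of "winv w" "[linv x]"] Cons v' by simp
  then show ?case using emit_inv[OF Cons.prems(1)] by (simp add: rcos_rcos)
qed simp

text \<open>A backtracking pair emits a word followed by its inverse and returns to the vertex where
  it began.\<close>

lemma rho_red:
  assumes "v \<in> V" "fst ` set w \<subseteq> B"
  shows "red (rho v (red w)) = red (rho v w)"
  using assms
proof (induction w arbitrary: v)
  case (Cons x w)
  have v': "v \<rhd> [x] \<in> V" using Cons.prems V_act[of v "[x]"] by simp
  have IH: "red (rho v (x # w)) = red (emit v x @ rho (v \<rhd> [x]) (red w))"
    using Cons.IH[OF v'] Cons.prems by simp (metis red_append_right)
  show ?case
  proof (cases "\<exists>ys. red w = linv x # ys")
    case True
    then obtain ys where ys: "red w = linv x # ys" by blast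
    then show ?thesis
      using IH emit_inv[OF Cons.prems(1)] act_inv[OF Cons.prems(1)] by (simp add: red.simps(2)[of x w])
  next
    case False
    then have "red (x # w) = x # red w"
      by (auto simp: red.simps(2)[of x w] split: list.splits)
    then show ?thesis using IH by simp
  qed
qed simp

lemma rho_Nil:
  assumes "v \<in> V" "fst ` set w \<subseteq> B" "rho v w = []"
  shows "red (t v @ w) = t (v \<rhd> w)"
  using assms
proof (induction w arbitrary: v)
  case Nil
  then show ?case using t_carrier[of v] by (simp add: FG_carrier red_reduced act_Nil)
next
  case (Cons x w)
  have v': "v \<rhd> [x] \<in> V" using Cons.prems V_act[of v "[x]"] by simp
  have "red (t v @ x # w) = red (red (t v @ [x]) @ w)" by simp
  also have "\<dots> = red (t (v \<rhd> [x]) @ w)" using emit_Nil[of v x] Cons.prems by simp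
  also have "\<dots> = t (v \<rhd> [x] \<rhd> w)" using Cons.IH[OF v'] Cons.prems by simp
  finally show ?case by (simp add: rcos_rcos)
qed

text \<open>A tree has no nontrivial reduced closed path: by \<open>rho_Nil\<close>, following
  \<open>w\<close> leaves the representative \<open>t v\<close> unchanged, and \<open>t v\<close>
  cancels.\<close>

lemma closed_tree_path_Nil:
  assumes "v \<in> V" "fst ` set w \<subseteq> B" "rho v w = []" "v \<rhd> w = v" "reduced w"
  shows "w = []"
proof -
  have "red (t v @ w) = red (t v @ [])"
    using rho_Nil[OF assms(1-3)] assms t_carrier by (simp add: FG_carrier red_reduced)
  then show ?thesis using red_append_inj[of "t v" w "[]"] assms(5) by (simp add: red_reduced)
qed

lemma rho_t: "v \<in> V \<Longrightarrow> rho A (t v) = []"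
proof (induction "length (t v)" arbitrary: v rule: less_induct)
  case less
  show ?case
  proof (cases "v = A")
    case False
    then obtain v' x where *: "v' \<in> V" "fst x \<in> B" "v' \<rhd> [x] = v" "t v = t v' @ [x]"
      using t_step less.prems by blast
    then have "rho A (t v') = []" using less.hyps by simp
    then show ?thesis
      using * rho_append[OF A_in_V, of "t v'" "[x]"] t_carrier[of v'] emit_tree[of v' x] t_repr[of v']
      by (simp add: FG_carrier)
  qed (simp add: t_base)
qed

lemma rho_t_winv: "v \<in> V \<Longrightarrow> rho v (winv (t v)) = []"
  using rho_winv[OF A_in_V, of "t v"] t_carrier[of v] rho_t[of v] t_repr[of v] by (simp add: FG_carrier)

lemma emit_letter:
  assumes "v \<in> V" "fst x \<in> B" "emit v x = [e]"
  shows "(src v x, fst x) \<in> X" "e = (lab (src v x, fst x), snd x)"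
  using assms src_V by (auto simp: emit_def X_def split: if_splits)

text \<open>An emitted letter names its edge, as \<open>lab\<close> is injective on
  \<open>X\<close>, and its sign gives the direction; together they determine the starting
  vertex.\<close>

lemma emit_inj:
  assumes "v \<in> V" "fst x \<in> B" "emit v x = [e]" "v' \<in> V" "fst y \<in> B" "emit v' y = [e]"
  shows "v = v'" "x = y"
proof -
  note 1 = emit_letter[OF assms(1-3)] and 2 = emit_letter[OF assms(4-6)]
  have "src v x = src v' y" "fst x = fst y" "snd x = snd y"
    using 1 2 inj_onD[OF lab_inj, of "(src v x, fst x)" "(src v' y, fst y)"] by auto
  then show "x = y" by (simp add: prod_eq_iff)
  then show "v = v'"
    using \<open>src v x = src v' y\<close> act_inv[OF assms(1), of x] act_inv[OF assms(4), of x]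
    by (metis src_def)
qed

lemma rho_letters: "v \<in> V \<Longrightarrow> fst ` set w \<subseteq> B \<Longrightarrow> fst ` set (rho v w) \<subseteq> lab ` X"
proof (induction w arbitrary: v)
  case (Cons x w)
  have v': "v \<rhd> [x] \<in> V" using Cons.prems V_act[of v "[x]"] by simp
  have "fst ` set (emit v x) \<subseteq> lab ` X"
    using Cons.prems src_V[of v x] by (auto simp: emit_def X_def)
  then show ?case using Cons.IH[OF v'] Cons.prems by (simp add: image_Un)
qed simp

lemma rho_ConsD:
  assumes "v \<in> V" "fst ` set w \<subseteq> B" "rho v w = e # r"
  shows "\<exists>p y q. w = p @ y # q \<and> rho v p = [] \<and> emit (v \<rhd> p) y = [e]"
  using assms
proof (induction w arbitrary: v)
  case (Cons x w)
  have v': "v \<rhd> [x] \<in> V" using Cons.prems V_act[of v "[x]"] by simp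
  show ?case
  proof (cases "emit v x")
    case Nil
    then obtain p y q where "w = p @ y # q" "rho (v \<rhd> [x]) p = []" "emit (v \<rhd> [x] \<rhd> p) y = [e]"
      using Cons.IH[OF v'] Cons.prems by auto
    then show ?thesis
      using Nil by (intro exI[of _ "x # p"] exI[of _ y] exI[of _ q]) (simp add: rcos_rcos)
  next
    case (Cons e' l)
    then have "emit v x = [e]" using Cons.prems(3) by (auto simp: emit_def split: if_splits)
    then show ?thesis
      using Cons.prems by (intro exI[of _ "[]"] exI[of _ x] exI[of _ w]) (simp add: act_Nil)
  qed
qed simp

text \<open>Up to the first emitted edge the path stays in the tree, where reduced closed paths are empty.\<close>

lemma rho_first_letter:
  assumes "v \<in> V" "fst ` set w \<subseteq> B" "reduced w" "rho v w = e # r"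
    and "fst x \<in> B" "emit v x = [e]"
  shows "w \<noteq> []" "hd w = x"
proof -
  obtain p y q where w: "w = p @ y # q" "rho v p = []" "emit (v \<rhd> p) y = [e]"
    using rho_ConsD[OF assms(1,2,4)] by blast
  have vp: "v \<rhd> p \<in> V" using V_act[OF assms(1), of p] assms(2) w(1) by (simp add: image_Un)
  have "v \<rhd> p = v" "y = x"
    using emit_inj[OF vp _ w(3) assms(1,5,6)] assms(2) w(1) by auto
  moreover have "p = []"
    using closed_tree_path_Nil[OF assms(1) _ w(2)] assms(2,3) w(1) calculation
    by (simp add: reduced_append image_Un)
  ultimately show "w \<noteq> []" "hd w = x" using w by auto
qed

text \<open>If an emitted letter were followed by its inverse, the path between the two crossings
  would be a reduced closed path in the tree, hence empty, and \<open>w\<close> would backtrack. So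
  collapsing the tree creates no new cancellation.\<close>

lemma rho_reduced:
  assumes "v \<in> V" "fst ` set w \<subseteq> B" "reduced w"
  shows "reduced (rho v w)"
  using assms
proof (induction w arbitrary: v)
  case (Cons x w)
  have v': "v \<rhd> [x] \<in> V" using Cons.prems V_act[of v "[x]"] by simp
  have IH: "reduced (rho (v \<rhd> [x]) w)"
    using Cons.IH[OF v'] Cons.prems by (simp add: reduced_Cons)
  show ?case
  proof (cases "emit v x")
    case (Cons e l)
    then have e: "emit v x = [e]" by (auto simp: emit_def split: if_splits)
    have "hd (rho (v \<rhd> [x]) w) \<noteq> linv e" if "rho (v \<rhd> [x]) w \<noteq> []"
    proof
      assume "hd (rho (v \<rhd> [x]) w) = linv e"
      then obtain r where r: "rho (v \<rhd> [x]) w = linv e # r"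
        using \<open>rho (v \<rhd> [x]) w \<noteq> []\<close> by (metis list.collapse)
      have "emit (v \<rhd> [x]) (linv x) = [linv e]"
        using emit_inv[OF Cons.prems(1)] e by simp
      then have "w \<noteq> []" "hd w = linv x"
        using rho_first_letter[OF v' _ _ r, of "linv x"] Cons.prems by (simp_all add: reduced_Cons)
      then show False using Cons.prems(3) by (simp add: reduced_Cons)
    qed
    then show ?thesis using IH e by (auto simp: reduced_Cons)
  qed (use IH in simp)
qed simp

section \<open>The isomorphism from \<open>A\<close> to the free group on the labels\<close>

definition psi :: "'a letter list \<Rightarrow> 'c letter list" where
  "psi a = rho A a"

lemma psi_red: "fst ` set w \<subseteq> B \<Longrightarrow> psi (red w) = red (psi w)"
  unfolding psi_def using rho_red[OF A_in_V, of w] rho_reduced[OF A_in_V, of "red w"]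
    red_in_FG[of w B] by (simp add: FG_carrier red_reduced)

lemma psi_carrier: "a \<in> A \<Longrightarrow> psi a \<in> carrier (FG (lab ` X))"
  unfolding psi_def using rho_letters[OF A_in_V, of a] rho_reduced[OF A_in_V, of a]
    subgroup_FGD(4)[OF A] by (auto simp: FG_carrier)

lemma psi_mult: "a \<in> A \<Longrightarrow> b \<in> A \<Longrightarrow> psi (red (a @ b)) = red (psi a @ psi b)"
  using psi_red[of "a @ b"] subgroup_FGD(4)[OF A, of a] subgroup_FGD(4)[OF A, of b] A_act[of a]
  by (simp add: psi_def rho_append[OF A_in_V] FG_carrier image_Un)

lemma psi_winv: "a \<in> A \<Longrightarrow> psi (winv a) = winv (psi a)"
  unfolding psi_def using rho_winv[OF A_in_V, of a] A_act[of a] subgroup_FGD(4)[OF A, of a]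
  by (simp add: FG_carrier)

text \<open>The Schreier generator of an edge: go to its source through the tree, cross it, and
  return through the tree. Only the crossing is recorded.\<close>

lemma psi_generator:
  assumes e: "(v, b) \<in> X"
  shows "red (t v @ (b, True) # winv (t (v \<rhd> [(b, True)]))) \<in> A"
    "psi (red (t v @ (b, True) # winv (t (v \<rhd> [(b, True)])))) = [(lab (v, b), True)]"
proof -
  define v' where "v' = v \<rhd> [(b, True)]"
  define w where "w = t v @ (b, True) # winv (t v')"
  have v: "v \<in> V" "b \<in> B" "\<not> tree v b" using e by (auto simp: X_def)
  have v': "v' \<in> V" unfolding v'_def using V_act[of v "[(b, True)]"] v by simp
  have letters: "fst ` set (t v) \<subseteq> B" "fst ` set (t v') \<subseteq> B"
    using t_carrier v v' by (auto simp: FG_carrier)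
  then have w: "fst ` set w \<subseteq> B" using v by (simp add: w_def image_Un)
  have "A \<rhd> red w = A \<rhd> t v \<rhd> [(b, True)] \<rhd> winv (t v')"
    by (simp add: rcos_red rcos_rcos w_def)
  also have "\<dots> = A \<rhd> t v' \<rhd> winv (t v')"
    using t_repr v v' by (simp add: v'_def)
  also have "\<dots> = A"
    using rcos_red[of B A "t v' @ winv (t v')"] act_Nil[OF A_in_V] by (simp add: rcos_rcos)
  finally have "A \<rhd> red w = A" .
  then show "red (t v @ (b, True) # winv (t (v \<rhd> [(b, True)]))) \<in> A"
    using group.coset_join1[OF group_FG _ _ A, of "red w"] red_in_FG[OF w] subgroup.subset[OF A]
    by (simp add: w_def v'_def)
  have "psi w = [(lab (v, b), True)]"
    using v v' letters t_repr[of v] rho_t[of v] rho_t_winv[of v']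
    by (simp add: psi_def w_def rho_append[OF A_in_V] emit_def src_def flip: v'_def)
  then show "psi (red (t v @ (b, True) # winv (t (v \<rhd> [(b, True)])))) = [(lab (v, b), True)]"
    using psi_red[OF w] by (simp add: w_def v'_def red_reduced)
qed

lemma psi_surj:
  assumes "w \<in> carrier (FG (lab ` X))"
  shows "\<exists>a\<in>A. psi a = w"
  using assms
proof (induction w)
  case Nil
  then show ?case using subgroup_FGD(1)[OF A] by (intro bexI[of _ "[]"]) (simp_all add: psi_def)
next
  case (Cons x w)
  then obtain a where a: "a \<in> A" "psi a = w" by (auto simp: FG_carrier reduced_Cons)
  obtain v b s where x: "x = (lab (v, b), s)" "(v, b) \<in> X"
    using Cons.prems by (cases x) (auto simp: FG_carrier)
  obtain c where c: "c \<in> A" "psi c = [(lab (v, b), True)]"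
    using psi_generator[OF x(2)] by blast
  obtain d where d: "d \<in> A" "psi d = [x]"
  proof (cases s)
    case False
    then show ?thesis using that[of "winv c"] c psi_winv[of c] subgroup_FGD(2)[OF A] x by simp
  qed (use that c x in simp)
  have "psi (red (d @ a)) = x # w"
    using psi_mult[OF d(1) a(1)] a d Cons.prems by (simp add: FG_carrier red_reduced)
  then show ?case using subgroup_FGD(3)[OF A d(1) a(1)] by blast
qed

text \<open>For injectivity, the quotient of two elements with equal image is a reduced closed path
  that emits nothing, hence is empty.\<close>

lemma psi_iso: "psi \<in> iso (FG B \<lparr>carrier := A\<rparr>) (FG (lab ` X))"
proof -
  have hom: "psi \<in> hom (FG B \<lparr>carrier := A\<rparr>) (FG (lab ` X))"
    using psi_carrier psi_mult by (auto intro!: homI)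
  have "inj_on psi A"
  proof (rule inj_onI)
    fix a b assume ab: "a \<in> A" "b \<in> A" "psi a = psi b"
    have c: "red (a @ winv b) \<in> A" using ab subgroup_FGD[OF A] by blast
    have "psi (red (a @ winv b)) = []"
      using psi_mult[OF ab(1) subgroup_FGD(2)[OF A ab(2)]] psi_winv[OF ab(2)] ab(3) by simp
    then have "red (a @ winv b) = []"
      using closed_tree_path_Nil[OF A_in_V, of "red (a @ winv b)"] A_act[OF c]
        subgroup_FGD(4)[OF A c] by (simp add: psi_def FG_carrier)
    then have "red (a @ winv b @ b) = red b" by (metis append_Nil append_assoc red_append_left)
    then show "a = b" using ab subgroup_FGD(4)[OF A] by (simp add: FG_carrier red_reduced)
  qed
  moreover have "psi ` A = carrier (FG (lab ` X))"
    using psi_carrier psi_surj by blast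
  ultimately show ?thesis using hom by (simp add: iso_def bij_betw_def)
qed

lemma psi_inj: "a \<in> A \<Longrightarrow> b \<in> A \<Longrightarrow> psi a = psi b \<Longrightarrow> a = b"
  using psi_iso inj_onD[of psi A a b] by (simp add: iso_def bij_betw_def)

section \<open>Core graphs under the collapse\<close>

lemma psi_subgroup:
  assumes K: "subgroup K (FG B)" "K \<subseteq> A"
  shows "subgroup (psi ` K) (FG (lab ` X))"
proof (rule subgroup_FGI)
  show "psi ` K \<subseteq> carrier (FG (lab ` X))" using psi_carrier K by blast
  show "[] \<in> psi ` K"
    using subgroup_FGD(1)[OF K(1)] by (intro image_eqI[of _ _ "[]"]) (simp_all add: psi_def)
  show "winv x \<in> psi ` K" if x: "x \<in> psi ` K" for x
  proof -
    obtain a where a: "a \<in> K" "x = psi a" using x by blast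
    then have "winv x = psi (winv a)" using psi_winv[of a] K(2) by auto
    then show ?thesis using subgroup_FGD(2)[OF K(1) a(1)] by (rule image_eqI)
  qed
  show "red (x @ y) \<in> psi ` K" if xy: "x \<in> psi ` K" "y \<in> psi ` K" for x y
  proof -
    obtain a b where ab: "a \<in> K" "b \<in> K" "x = psi a" "y = psi b" using xy by blast
    then have "red (x @ y) = psi (red (a @ b))"
      using psi_mult[OF subsetD[OF K(2) ab(1)] subsetD[OF K(2) ab(2)]] by simp
    then show ?thesis using subgroup_FGD(3)[OF K(1) ab(1,2)] by (rule image_eqI)
  qed
qed

text \<open>A vertex of the graph of \<open>K\<close> over \<open>v\<close> is the coset of some
  product of an \<open>a\<close> in \<open>A\<close> with \<open>t v\<close>; it is sent to the
  coset of \<open>psi a\<close>. Values at lifts of tree edges carry no geometric meaning.\<close>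

definition collapse :: "'a letter list set \<Rightarrow> 'a letter list set \<times> 'a \<Rightarrow> 'c letter list set \<times> 'c" where
  "collapse K e = (let c = SOME c. c \<in> fst e; v = A \<rhd> c in
     (psi ` K #>\<^bsub>FG (lab ` X)\<^esub> psi (red (c @ winv (t v))), lab (v, snd e)))"

lemma collapse_eq:
  assumes K: "subgroup K (FG B)" "K \<subseteq> A" and a: "a \<in> A" and v: "v \<in> V"
  shows "collapse K (K \<rhd> red (a @ t v), b) = (psi ` K #>\<^bsub>FG (lab ` X)\<^esub> psi a, lab (v, b))"
proof -
  define c where "c = (SOME c. c \<in> K \<rhd> red (a @ t v))"
  have "red ([] @ red (a @ t v)) \<in> K \<rhd> red (a @ t v)"
    unfolding FG_rcos using subgroup_FGD(1)[OF K(1)] by blast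
  then have "c \<in> K \<rhd> red (a @ t v)"
    unfolding c_def by (rule someI)
  then obtain k where k: "k \<in> K" and ck: "c = red (k @ a @ t v)"
    by (auto simp: FG_rcos)
  then have c: "c = red (red (k @ a) @ t v)" by simp
  have ka: "red (k @ a) \<in> A" using k K a subgroup_FGD(3)[OF A] by blast
  have Ac: "A \<rhd> c = v"
    using c rcos_absorb[OF A ka, of "t v"] t_repr[OF v] by simp
  have "red (c @ winv (t v)) = red ((k @ a) @ t v @ winv (t v))" by (simp add: ck)
  also have "\<dots> = red (k @ a)" by (simp only: red_winv_cancel_end)
  finally have "psi (red (c @ winv (t v))) = red (psi k @ psi a)"
    using psi_mult k K a by auto
  moreover have "psi ` K #>\<^bsub>FG (lab ` X)\<^esub> red (psi k @ psi a) = psi ` K #>\<^bsub>FG (lab ` X)\<^esub> psi a"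
    using rcos_absorb[OF psi_subgroup[OF K]] k by simp
  ultimately show ?thesis
    unfolding collapse_def Let_def fst_conv snd_conv using Ac by (simp flip: c_def)
qed

text \<open>A cyclically reduced loop after the collapse lifts to a cyclically reduced loop before
  it that starts with the corresponding edge. This inclusion alone yields the bound on the number of
  edges.\<close>

lemma core_edges_collapse:
  assumes K: "subgroup K (FG B)" "K \<subseteq> A"
  shows "core_edges (FG (lab ` X)) (psi ` K) \<subseteq> collapse K ` core_edges (FG B) K"
proof
  fix e assume e: "e \<in> core_edges (FG (lab ` X)) (psi ` K)"
  from in_core_edgesD[OF psi_subgroup[OF K] e] obtain g w l where
    e: "e = (psi ` K #>\<^bsub>FG (lab ` X)\<^esub> g, l)" and g: "g \<in> carrier (FG (lab ` X))"
    and w: "w \<in> carrier (FG (lab ` X))" "cyc_reduced w" "w \<noteq> []" "hd w = (l, True)"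
    and conj: "red (g @ w @ winv g) \<in> psi ` K" .
  obtain a where a: "a \<in> A" "psi a = g" using psi_surj[OF g] by blast
  obtain z where z: "z \<in> A" "psi z = w" using psi_surj[OF w(1)] by blast
  obtain k where k: "k \<in> K" "psi k = red (g @ w @ winv g)" using conj by auto
  have "l \<in> lab ` X" using w by (cases w) (auto simp: FG_carrier)
  then obtain v b where l: "l = lab (v, b)" and vbX: "(v, b) \<in> X" by auto
  then have v: "v \<in> V" and b: "b \<in> B" and nt: "\<not> tree v b" by (auto simp: X_def)
  have letters: "fst ` set (t v) \<subseteq> B" "fst ` set z \<subseteq> B" "fst ` set a \<subseteq> B"
    using t_carrier[OF v] subgroup_FGD(4)[OF A] z a by (auto simp: FG_carrier)
  \<comment> \<open>\<open>z\<close> is a loop at the base vertex; conjugating by the tree path to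
    \<open>v\<close> turns it into a loop at \<open>v\<close>. The added pieces emit nothing, so it
    still collapses to \<open>w\<close>.\<close>
  define u0 where "u0 = winv (t v) @ z @ t v"
  define u where "u = red u0"
  define g0 where "g0 = red (a @ t v)"
  have u0: "fst ` set u0 \<subseteq> B" using letters by (simp add: u0_def image_Un)
  have u: "u \<in> carrier (FG B)" unfolding u_def using red_in_FG[OF u0] .
  have g0: "g0 \<in> carrier (FG B)"
    unfolding g0_def using letters by (intro red_in_FG) (simp add: image_Un)
  have zk: "red (a @ z @ winv a) = k"
  proof (rule psi_inj)
    have "psi (red (a @ red (z @ winv a))) = red (g @ red (w @ winv g))"
      using psi_mult[of a "red (z @ winv a)"] psi_mult[of z "winv a"] a z psi_winv[of a]
        subgroup_FGD(2,3)[OF A] by simp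
    then show "psi (red (a @ z @ winv a)) = psi k" using k by simp
    have "red (a @ red (z @ winv a)) \<in> A" using a z subgroup_FGD(2,3)[OF A] by blast
    then show "red (a @ z @ winv a) \<in> A" by simp
  qed (use k K in blast)
  have "red (g0 @ u @ winv g0) = red (a @ t v @ winv (t v) @ z @ t v @ winv (t v) @ winv a)"
    by (simp add: g0_def u_def u0_def winv_red)
      (metis append_assoc red_append_right)
  also have "\<dots> = red ((a @ z) @ t v @ winv (t v) @ winv a)"
    by (subst red_winv_cancel_mid) simp
  also have "\<dots> = k" by (subst red_winv_cancel_mid) (simp add: zk)
  finally have conj0: "red (g0 @ u @ winv g0) \<in> K" using k by simp
  have base: "v \<rhd> winv (t v) = A"
    using t_repr[OF v] rcos_red[of B A "t v @ winv (t v)"] act_Nil[OF A_in_V]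
    by (metis rcos_rcos red_winv_cancel_end(3))
  have "rho v u0 = w"
    using letters z A_act[OF z(1)] rho_t_winv[OF v] rho_t[OF v] rho_append[OF v, of "winv (t v)"]
      rho_append[OF A_in_V, of z] base
    by (simp add: u0_def psi_def)
  then have rho_u: "rho v u = w"
    using rho_red[OF v u0] rho_reduced[OF v, of u] u w(1) by (simp add: u_def FG_carrier red_reduced)
  have vu: "v \<rhd> u = v"
  proof -
    have "v \<rhd> u = v \<rhd> winv (t v) \<rhd> z \<rhd> t v" by (simp add: u_def u0_def rcos_red rcos_rcos)
    then show ?thesis using base A_act[OF z(1)] t_repr[OF v] by simp
  qed
  obtain r where r: "w = (l, True) # r" using w by (cases w) auto
  have "emit v (b, True) = [(l, True)]" using nt l by (simp add: emit_def src_def)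
  then have hd_u: "u \<noteq> []" "hd u = (b, True)"
    using rho_first_letter[OF v _ _ rho_u[unfolded r], of "(b, True)"] u b by (auto simp: FG_carrier)
  \<comment> \<open>As \<open>u\<close> closes up at \<open>v\<close>, a final inverse of
    \<open>b\<close> would cross the edge \<open>(v, b)\<close> backwards, so \<open>w\<close> would
    end in the inverse of its first letter.\<close>
  have "last u \<noteq> (b, False)"
  proof
    assume "last u = (b, False)"
    then obtain u' where u': "u = u' @ [(b, False)]" using hd_u(1) by (metis append_butlast_last_id)
    have "fst ` set u' \<subseteq> B" using u u' by (simp add: FG_carrier image_Un)
    then have "w = rho v u' @ emit (v \<rhd> u') (b, False)"
      using rho_append[OF v, of u' "[(b, False)]"] rho_u u' by simp
    moreover have "emit (v \<rhd> u') (b, False) = [(l, False)]"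
      using vu u' nt l by (simp add: emit_def src_def rcos_rcos)
    ultimately have "last w = (l, False)" by simp
    then show False using w by (simp add: cyc_reduced_def)
  qed
  then have "cyc_reduced u"
    using u hd_u by (cases "last u") (auto simp: cyc_reduced_def FG_carrier)
  then have "(K \<rhd> g0, b) \<in> core_edges (FG B) K"
    using in_core_edgesI[OF g0 u _ hd_u conj0] by simp
  moreover have "e = collapse K (K \<rhd> g0, b)"
    using collapse_eq[OF K a(1) v] a e l by (simp add: g0_def)
  ultimately show "e \<in> collapse K ` core_edges (FG B) K" by blast
qed

end

section \<open>Existence of a transversal of shortest representatives\<close>

lemma schreier_transversal_exists:
  assumes A: "subgroup A (FG B)"
  obtains t where "\<And>v. v \<in> rcosets\<^bsub>FG B\<^esub> A \<Longrightarrow> t v \<in> v" "t A = []"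
    "\<And>v. v \<in> rcosets\<^bsub>FG B\<^esub> A \<Longrightarrow> v \<noteq> A \<Longrightarrow>
      \<exists>v' x. v' \<in> rcosets\<^bsub>FG B\<^esub> A \<and> fst x \<in> B \<and> v' #>\<^bsub>FG B\<^esub> [x] = v \<and> t v = t v' @ [x]"
proof -
  let ?V = "rcosets\<^bsub>FG B\<^esub> A"
  \<comment> \<open>\<open>d\<close> is the distance from the base vertex. \<open>pred\<close> picks
    a neighbour one step closer together with the connecting letter, and \<open>T n\<close> follows
    \<open>n\<close> such steps back, so that \<open>T (d v) v\<close> spells a shortest
    path.\<close>
  define d :: "'a letter list set \<Rightarrow> nat" where "d v = (LEAST n. n \<in> length ` v)" for v
  define pred where "pred v = (SOME (v', x). v' \<in> ?V \<and> fst x \<in> B \<and>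
    v' #>\<^bsub>FG B\<^esub> [x] = v \<and> d v = Suc (d v'))" for v
  define T :: "nat \<Rightarrow> 'a letter list set \<Rightarrow> 'a letter list" where
    "T = rec_nat (\<lambda>v. []) (\<lambda>n f v. f (fst (pred v)) @ [snd (pred v)])"
  have T_simps: "T 0 v = []" "T (Suc n) v = T n (fst (pred v)) @ [snd (pred v)]" for n v
    by (simp_all add: T_def)
  have V_repr: "v = A #>\<^bsub>FG B\<^esub> g" "g \<in> carrier (FG B)" if vg: "v \<in> ?V" "g \<in> v" for v g
  proof -
    obtain g0 where g0: "v = A #>\<^bsub>FG B\<^esub> g0" using vg(1) by (auto simp: RCOSETS_def)
    then obtain a where "a \<in> A" "g = red (a @ g0)" using vg by (auto simp: FG_rcos)
    then show "v = A #>\<^bsub>FG B\<^esub> g" using rcos_absorb[OF A] g0 by metis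
    show "g \<in> carrier (FG B)" using subgroup.rcosets_carrier[OF A group_FG] vg by blast
  qed
  have d_le: "d v \<le> length g" if "g \<in> v" for v g
    unfolding d_def using that by (intro Least_le[of "\<lambda>n. n \<in> length ` v"]) simp
  have V_mem: "g \<in> A #>\<^bsub>FG B\<^esub> g" if "g \<in> carrier (FG B)" for g
    using that subgroup_FGD(1)[OF A] unfolding FG_rcos
    by (intro image_eqI[of _ _ "[]"]) (simp_all add: FG_carrier red_reduced)
  have d_ex: "\<exists>g\<in>v. length g = d v" if v: "v \<in> ?V" for v
  proof -
    obtain g where "g \<in> carrier (FG B)" "v = A #>\<^bsub>FG B\<^esub> g" using v by (auto simp: RCOSETS_def)
    then have "length g \<in> length ` v" using V_mem[of g] by blast
    then have "d v \<in> length ` v"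
      unfolding d_def by (rule LeastI[of "\<lambda>n. n \<in> length ` v"])
    then show ?thesis by auto
  qed
  have A_coset: "A #>\<^bsub>FG B\<^esub> [] = A"
    using group.coset_join2[OF group_FG _ A, of "[]"] subgroup_FGD[OF A] by blast
  have pred: "fst (pred v) \<in> ?V \<and> fst (snd (pred v)) \<in> B \<and>
      fst (pred v) #>\<^bsub>FG B\<^esub> [snd (pred v)] = v \<and> d v = Suc (d (fst (pred v)))"
    if v: "v \<in> ?V" "v \<noteq> A" for v
  proof -
    \<comment> \<open>Dropping the last letter of a shortest representative gives a coset exactly
      one step closer: if it were closer still, putting the letter back would beat
      \<open>d v\<close>.\<close>
    obtain g where g: "g \<in> v" "length g = d v" using d_ex v by blast
    have vg: "v = A #>\<^bsub>FG B\<^esub> g" "g \<in> carrier (FG B)" using V_repr[OF v(1) g(1)] .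
    then have "g \<noteq> []" using v(2) A_coset by auto
    then obtain u x where gu: "g = u @ [x]" by (metis rev_exhaust)
    have u: "u \<in> carrier (FG B)" "fst x \<in> B"
      using vg(2) gu by (auto simp: FG_carrier reduced_append)
    define v' where "v' = A #>\<^bsub>FG B\<^esub> u"
    have v': "v' \<in> ?V" "v' #>\<^bsub>FG B\<^esub> [x] = v"
      using u vg gu by (auto simp: v'_def RCOSETS_def rcos_rcos)
    have "d v' \<le> length u" using d_le V_mem[OF u(1)] by (simp add: v'_def)
    moreover obtain h where h: "h \<in> v'" "length h = d v'" using d_ex v' by blast
    have "red (h @ [x]) \<in> v" using h v'(2) by (auto simp: FG_rcos)
    then have "d v \<le> length (red (h @ [x]))" by (rule d_le)
    then have "d v \<le> Suc (d v')" using length_red[of "h @ [x]"] h by simp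
    ultimately have "d v = Suc (d v')" using g gu by simp
    then have "case (v', x) of (v', x) \<Rightarrow>
        v' \<in> ?V \<and> fst x \<in> B \<and> v' #>\<^bsub>FG B\<^esub> [x] = v \<and> d v = Suc (d v')"
      using v' u by simp
    from someI[of "\<lambda>(v', x). v' \<in> ?V \<and> fst x \<in> B \<and> v' #>\<^bsub>FG B\<^esub> [x] = v \<and> d v = Suc (d v')", OF this]
    show ?thesis by (simp add: pred_def split_beta)
  qed
  define t where "t v = T (d v) v" for v
  have dA: "d A = 0"
    using d_le[OF subgroup_FGD(1)[OF A]] by simp
  have t_A: "t A = []" by (simp add: t_def dA T_simps)
  have step: "t v = t (fst (pred v)) @ [snd (pred v)]" if "v \<in> ?V" "v \<noteq> A" for v
    using pred[OF that] by (simp add: t_def T_simps)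
  have t_mem: "t v \<in> v \<and> length (t v) = d v" if "v \<in> ?V" for v
    using that
  proof (induction "d v" arbitrary: v rule: less_induct)
    case less
    show ?case
    proof (cases "v = A")
      case True
      then show ?thesis using t_A dA subgroup_FGD(1)[OF A] by simp
    next
      case False
      define v' x where "v' = fst (pred v)" and "x = snd (pred v)"
      have v': "v' \<in> ?V" "v' #>\<^bsub>FG B\<^esub> [x] = v" "d v = Suc (d v')" "t v = t v' @ [x]"
        using pred step less.prems False by (simp_all add: v'_def x_def)
      then have IH: "t v' \<in> v'" "length (t v') = d v'" using less.hyps[of v'] by auto
      then have mem: "red (t v) \<in> v" using v' by (auto simp: FG_rcos)
      \<comment> \<open>The reduced word lies in \<open>v\<close> and cannot be shorter than
        \<open>d v\<close>, which is the length of \<open>t v\<close>; so \<open>t v\<close> is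
        already reduced.\<close>
      have "length (red (t v)) = length (t v)"
        using d_le[OF mem] length_red[of "t v"] IH v' by simp
      then show ?thesis using mem red_eq_self_if_length[of "t v"] IH v' by simp
    qed
  qed
  show thesis
    by (rule that[of t]) (use t_mem t_A pred step in blast)+
qed

section \<open>Gersten representatives\<close>

lemma fg_subgroup_image:
  assumes \<alpha>: "\<alpha> \<in> hom (FG B) (FG C)" and H: "fg_subgroup (FG B) H"
  shows "fg_subgroup (FG C) (\<alpha> ` H)"
proof -
  have gh: "group_hom (FG B) (FG C) \<alpha>"
    using \<alpha> by (simp add: group_hom_def group_hom_axioms_def group_FG)
  from H obtain S where S: "finite S" "S \<subseteq> carrier (FG B)" "H = generate (FG B) S"
    and sub: "subgroup H (FG B)" by (auto simp: fg_subgroup_def)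
  have "\<alpha> ` S \<subseteq> carrier (FG C)" using S(2) hom_in_carrier[OF \<alpha>] by blast
  then show ?thesis
    using S group_hom.generate_img[OF gh S(2)] group_hom.subgroup_img_is_subgroup[OF gh sub]
    unfolding fg_subgroup_def by (metis finite_imageI)
qed

lemma complexity_FG_mono:
  assumes "\<forall>H\<in>set Hs. subgroup H (FG B')" "B' \<subseteq> B"
  shows "complexity (FG B') Hs = complexity (FG B) Hs"
  unfolding complexity_def using core_edges_FG_mono[OF _ assms(2)] assms(1)
  by (metis (mono_tags, lifting) map_eq_conv)

text \<open>The new automorphism is \<open>\<alpha>\<close> followed by the collapse of a spanning
  tree for its image; \<open>core_edges_collapse\<close> bounds the edges for all \<open>H\<close>
  at once, with the same \<open>\<beta>\<close>.\<close>

lemma collapse_to_automorphism: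
  fixes B B' :: "'a set"
  assumes B: "finite B" "finite B'" and \<alpha>: "\<alpha> \<in> hom (FG B') (FG B)" "inj_on \<alpha> (carrier (FG B'))"
  obtains \<beta> where "\<beta> \<in> iso (FG B') (FG B')"
    "\<And>H. fg_subgroup (FG B') H \<Longrightarrow>
      card (core_edges (FG B') (\<beta> ` H)) \<le> card (core_edges (FG B) (\<alpha> ` H))"
proof -
  define A where "A = \<alpha> ` carrier (FG B')"
  have gh: "group_hom (FG B') (FG B) \<alpha>"
    using \<alpha> by (simp add: group_hom_def group_hom_axioms_def group_FG)
  have A: "subgroup A (FG B)"
    unfolding A_def using group_hom.subgroup_img_is_subgroup[OF gh group.subgroup_self[OF group_FG]] .
  have \<alpha>_iso: "\<alpha> \<in> iso (FG B') (FG B \<lparr>carrier := A\<rparr>)"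
    using \<alpha> by (auto simp: iso_def hom_def bij_betw_def A_def)
  obtain t where t: "\<And>v. v \<in> rcosets\<^bsub>FG B\<^esub> A \<Longrightarrow> t v \<in> v" "t A = []"
    "\<And>v. v \<in> rcosets\<^bsub>FG B\<^esub> A \<Longrightarrow> v \<noteq> A \<Longrightarrow>
      \<exists>v' x. v' \<in> rcosets\<^bsub>FG B\<^esub> A \<and> fst x \<in> B \<and> v' #>\<^bsub>FG B\<^esub> [x] = v \<and> t v = t v' @ [x]"
    using schreier_transversal_exists[OF A] by blast
  \<comment> \<open>First the edges serve as their own labels. This shows that \<open>A\<close> is
    free on the edges outside the tree, so they are as many as the elements of
    \<open>B'\<close>.\<close>
  interpret S1: schreier B A t "\<lambda>e. e"
    by (rule schreier.intro[OF A t]) (auto intro: inj_onI)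
  have "S1.psi \<circ> \<alpha> \<in> iso (FG B') (FG S1.X)"
    using iso_set_trans[OF \<alpha>_iso S1.psi_iso] by simp
  then obtain f where f: "bij_betw f S1.X B'"
    using FG_iso_bij_betw[OF _ B(2)] by blast
  \<comment> \<open>The same tree is now relabelled by the bijection \<open>f\<close>, so that the
    collapse lands in the free group on \<open>B'\<close> itself.\<close>
  interpret S2: schreier B A t f
    by (rule schreier.intro[OF A t]) (use f in \<open>simp_all add: bij_betw_def S1.X_def S1.tree_def\<close>)
  have X: "f ` S2.X = B'" using f by (simp add: bij_betw_def)
  have psi_iso: "S2.psi \<circ> \<alpha> \<in> iso (FG B') (FG B')"
    using iso_set_trans[OF \<alpha>_iso S2.psi_iso] X by simp
  show thesis
  proof (rule that[OF psi_iso])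
    fix H assume H: "fg_subgroup (FG B') H"
    have fg: "fg_subgroup (FG B) (\<alpha> ` H)" using fg_subgroup_image[OF \<alpha>(1) H] .
    have sub: "subgroup (\<alpha> ` H) (FG B)" using fg by (simp add: fg_subgroup_def)
    have "H \<subseteq> carrier (FG B')" using H subgroup.subset by (auto simp: fg_subgroup_def)
    then have "\<alpha> ` H \<subseteq> A" by (auto simp: A_def)
    from S2.core_edges_collapse[OF sub this]
    show "card (core_edges (FG B') ((S2.psi \<circ> \<alpha>) ` H)) \<le> card (core_edges (FG B) (\<alpha> ` H))"
      using surj_card_le[OF finite_core_edges[OF fg B(1)]] X by (simp add: image_comp)
  qed
qed

theorem lemma9p13:
  fixes B B' :: "'a set" and Hs :: "('a \<times> bool) list set list"
  assumes "finite B" and "B' \<subseteq> B"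
    and "\<forall>H \<in> set Hs. fg_subgroup (FG B') H"
  shows "gersten_rep (FG B') Hs \<longleftrightarrow> gersten_rep (FG B) Hs"
proof
  have subgroups: "\<forall>H\<in>set Hs. subgroup H (FG B')"
    using assms(3) by (simp add: fg_subgroup_def)
  note complexity_Hs = complexity_FG_mono[OF subgroups assms(2)]
  {
    assume min: "gersten_rep (FG B') Hs"
    show "gersten_rep (FG B) Hs"
      unfolding gersten_rep_def
    proof
      fix \<alpha> assume \<alpha>: "\<alpha> \<in> iso (FG B) (FG B)"
      then have "\<alpha> \<in> hom (FG B') (FG B)" "inj_on \<alpha> (carrier (FG B'))"
        using FG_carrier_mono[OF assms(2)]
        by (auto simp: iso_def hom_def bij_betw_def Pi_iff subset_iff intro: inj_on_subset)
      then obtain \<beta> where \<beta>: "\<beta> \<in> iso (FG B') (FG B')"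
        and le: "\<And>H. fg_subgroup (FG B') H \<Longrightarrow>
          card (core_edges (FG B') (\<beta> ` H)) \<le> card (core_edges (FG B) (\<alpha> ` H))"
        using collapse_to_automorphism[OF assms(1) finite_subset[OF assms(2,1)]] by blast
      \<comment> \<open>The complexity of \<open>Hs\<close> is the same over both bases, so
        minimality over \<open>B'\<close> applies to \<open>\<beta>\<close>; the collapse then
        compares \<open>\<beta>\<close> with \<open>\<alpha>\<close> term by term.\<close>
      have "complexity (FG B) Hs \<le> complexity (FG B') (map (\<lambda>H. \<beta> ` H) Hs)"
        using min \<beta> complexity_Hs by (simp add: gersten_rep_def)
      also have "\<dots> \<le> complexity (FG B) (map (\<lambda>H. \<alpha> ` H) Hs)"
        unfolding complexity_def map_map o_def
        using le assms(3) by (intro sum_list_mono) simp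
      finally show "complexity (FG B) Hs \<le> complexity (FG B) (map (\<lambda>H. \<alpha> ` H) Hs)" .
    qed
  next
    assume min: "gersten_rep (FG B) Hs"
    show "gersten_rep (FG B') Hs"
      unfolding gersten_rep_def
    proof
      fix \<beta> assume \<beta>: "\<beta> \<in> iso (FG B') (FG B')"
      then have hom: "\<beta> \<in> hom (FG B') (FG B')" by (simp add: iso_def)
      define \<alpha> where "\<alpha> = extend_hom B' \<beta>"
      have \<alpha>: "\<alpha> \<in> iso (FG B) (FG B)"
        unfolding \<alpha>_def using extend_hom_iso[OF assms(2) \<beta>] .
      have "\<alpha> ` H = \<beta> ` H" if "H \<in> set Hs" for H
        using that subgroups subgroup.subset[of H "FG B'"] extend_hom_extends[OF assms(2) hom]
        by (intro image_cong) (auto simp: \<alpha>_def)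
      then have eq: "map (\<lambda>H. \<alpha> ` H) Hs = map (\<lambda>H. \<beta> ` H) Hs" by simp
      have "\<forall>H\<in>set (map (\<lambda>H. \<beta> ` H) Hs). subgroup H (FG B')"
        using fg_subgroup_image[OF hom] assms(3) by (auto simp: fg_subgroup_def)
      then have "complexity (FG B') (map (\<lambda>H. \<beta> ` H) Hs) = complexity (FG B) (map (\<lambda>H. \<alpha> ` H) Hs)"
        using complexity_FG_mono[OF _ assms(2)] eq by metis
      then show "complexity (FG B') Hs \<le> complexity (FG B') (map (\<lambda>H. \<beta> ` H) Hs)"
        using min \<alpha> complexity_Hs by (simp add: gersten_rep_def)
    qed
  }
qed

end
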